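(* Let $s\in(0,1)$, let $\Omega\subset\mathbb{R}^N$ be a bounded $\mathcal{C}^2$ domain, let $q\in L^\infty(\Omega;\mathbb{R}^N)$, and let $c_0\in\mathbb{R}$. Let $u\in\mathcal{C}^2(\overline\Omega)\cap\mathcal{C}(\mathbb{R}^N)$ be bounded on $\mathbb{R}^N$ and satisfy $$-\Delta u+(-\Delta)^s u+q\cdot\nabla u\ge0\quad\text{in }\Omega.$$ Let $x_0\in\partial\Omega$, and assume that $u=c_0$ on $B_{R_0}(x_0)\cap\partial\Omega$ for some $R_0>0$ and $u\ge c_0$ in $\mathbb{R}^N$. If $u\not\equiv c_0$ in $\mathbb{R}^N$, then $\partial_\nu u(x_0)<0$, where $\nu$ is the outer unit normal to $\partial\Omega$ at $x_0$.
   Context: The fractional Laplacian is $(-\Delta)^s u(x)=C_{N,s}\lim_{\varepsilon\to0^+}\int_{\mathbb{R}^N\setminus B_\varepsilon(x)}\frac{u(x)-u(y)}{|x-y|^{N+2s}}\,dy$, with $C_{N,s}=\pi^{-N/2}2^{2s}s\,\Gamma(\frac N2+s)/\Gamma(1-s)$. *)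

theory Defs
  imports "HOL-Analysis.Analysis"
begin

definition d1 :: "('a::euclidean_space \<Rightarrow> real) \<Rightarrow> 'a \<Rightarrow> 'a \<Rightarrow> real" where
  "d1 u b x = frechet_derivative u (at x) b"

definition d2 :: "('a::euclidean_space \<Rightarrow> real) \<Rightarrow> 'a \<Rightarrow> 'a \<Rightarrow> 'a \<Rightarrow> real" where
  "d2 u b c x = frechet_derivative (d1 u b) (at x) c"

definition C2_on :: "'a::euclidean_space set \<Rightarrow> ('a \<Rightarrow> real) \<Rightarrow> bool" where
  "C2_on S f \<longleftrightarrow>
     (\<forall>x\<in>S. f differentiable (at x)) \<and>
     (\<forall>b\<in>Basis. \<forall>x\<in>S. d1 f b differentiable (at x)) \<and>
     (\<forall>b\<in>Basis. \<forall>c\<in>Basis. continuous_on S (d2 f b c))"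

definition C2_closure :: "'a::euclidean_space set \<Rightarrow> ('a \<Rightarrow> real) \<Rightarrow> bool" where
  "C2_closure \<Omega> u \<longleftrightarrow>
     C2_on \<Omega> u \<and> continuous_on (closure \<Omega>) u \<and>
     (\<forall>b\<in>Basis. \<exists>g. continuous_on (closure \<Omega>) g \<and> (\<forall>x\<in>\<Omega>. g x = d1 u b x)) \<and>
     (\<forall>b\<in>Basis. \<forall>c\<in>Basis. \<exists>g. continuous_on (closure \<Omega>) g \<and> (\<forall>x\<in>\<Omega>. g x = d2 u b c x))"

definition hproj :: "'a::euclidean_space \<Rightarrow> 'a \<Rightarrow> 'a" where
  "hproj e x = x - (x \<bullet> e) *\<^sub>R e"

text \<open>A local C^2 boundary chart at x0: in the ball of radius r around x0, Omega is the
  region below the graph of a C^2 function phi over the hyperplane orthogonal to e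
  (i.e. after a rotation, Omega is locally {x_N < phi(x')}).\<close>
definition C2_chart :: "'a::euclidean_space set \<Rightarrow> 'a \<Rightarrow> real \<Rightarrow> 'a \<Rightarrow> ('a \<Rightarrow> real) \<Rightarrow> bool" where
  "C2_chart \<Omega> x0 r e \<phi> \<longleftrightarrow>
     0 < r \<and> norm e = 1 \<and> C2_on UNIV \<phi> \<and>
     \<Omega> \<inter> ball x0 r = {x \<in> ball x0 r. x \<bullet> e < \<phi> (hproj e x)}"

definition C2_domain :: "'a::euclidean_space set \<Rightarrow> bool" where
  "C2_domain \<Omega> \<longleftrightarrow> open \<Omega> \<and> connected \<Omega> \<and> \<Omega> \<noteq> {} \<and>
     (\<forall>x0\<in>frontier \<Omega>. \<exists>r e \<phi>. C2_chart \<Omega> x0 r e \<phi>)"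

definition grad :: "('a::euclidean_space \<Rightarrow> real) \<Rightarrow> 'a \<Rightarrow> 'a" where
  "grad f x = (\<Sum>b\<in>Basis. frechet_derivative f (at x) b *\<^sub>R b)"

text \<open>nu is the outer unit normal to the boundary of Omega at x0: computed in a C^2 chart
  as the normalised gradient of the local defining function x \<bullet> e - phi(x').\<close>
definition outer_unit_normal :: "'a::euclidean_space set \<Rightarrow> 'a \<Rightarrow> 'a \<Rightarrow> bool" where
  "outer_unit_normal \<Omega> x0 \<nu> \<longleftrightarrow>
     (\<exists>r e \<phi>. C2_chart \<Omega> x0 r e \<phi> \<and>
        (let \<psi> = (\<lambda>x. x \<bullet> e - \<phi> (hproj e x)) in \<nu> = (1 / norm (grad \<psi> x0)) *\<^sub>R grad \<psi> x0))"

text \<open>Normal derivative at a boundary point of u in C^2(closure Omega): the value at x0 of the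
  continuous extension of the directional derivative along nu.\<close>
definition normal_deriv :: "'a::euclidean_space set \<Rightarrow> ('a \<Rightarrow> real) \<Rightarrow> 'a \<Rightarrow> 'a \<Rightarrow> real" where
  "normal_deriv \<Omega> u x0 \<nu> = Lim (at x0 within \<Omega>) (\<lambda>x. frechet_derivative u (at x) \<nu>)"

definition laplacian :: "('a::euclidean_space \<Rightarrow> real) \<Rightarrow> 'a \<Rightarrow> real" where
  "laplacian u x = (\<Sum>b\<in>Basis. d2 u b b x)"

definition frac_const :: "nat \<Rightarrow> real \<Rightarrow> real" where
  "frac_const N s = pi powr (- real N / 2) * 2 powr (2 * s) * s
      * Gamma (real N / 2 + s) / Gamma (1 - s)"

definition frac_lap :: "real \<Rightarrow> ('a::euclidean_space \<Rightarrow> real) \<Rightarrow> 'a \<Rightarrow> real" where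
  "frac_lap s u x = frac_const DIM('a) s *
     Lim (at_right 0) (\<lambda>\<epsilon>. LINT y : - ball x \<epsilon> | lborel.
            (u x - u y) / dist x y powr (real DIM('a) + 2 * s))"

end

theory Submission
  imports Defs
begin

text \<open>Pairing \<open>x + h\<close> with \<open>x - h\<close> writes the fractional Laplacian on \<open>\<Omega>\<close> as an absolutely
  convergent integral that depends continuously on \<open>x\<close>, so the differential inequality, with
  \<open>q \<cdot> \<nabla>u\<close> relaxed to \<open>C |\<nabla>u|\<close>, holds at every point of \<open>\<Omega>\<close>. If \<open>u\<close> attained \<open>c0\<close> inside
  \<open>\<Omega>\<close>, the nonlocal term there would be strictly negative; hence \<open>u > c0\<close> in \<open>\<Omega>\<close>. In an interior
  ball touching \<open>x0\<close> the classical barrier \<open>exp (-\<alpha> |x - y|^2) - exp (-\<alpha> r^2)\<close> works: where a small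
  multiple of it touches \<open>u - c0\<close> from below up to a constant, convexity of \<open>exp\<close> bounds the nonlocal
  term by \<open>O(\<alpha>)\<close> times the Gaussian, whereas the Laplacian contributes order \<open>\<alpha>^2\<close>. So \<open>u - c0\<close>
  grows at least linearly along the inner normal.\<close>

section \<open>Integrability of the truncated singular kernel\<close>

text \<open>Dyadic shells with natural-number indices, separately inside and outside the unit ball,
  so that an estimate over all radii becomes two series over \<open>nat\<close>.\<close>

lemma dyadic_bracket:
  fixes x :: real
  assumes "0 < x"
  obtains k :: nat where "2 powr (- real k - 1) \<le> x" "x < 2 powr (- real k)" "x < 1"
  | k :: nat where "2 powr real k \<le> x" "x < 2 powr (real k + 1)" "1 \<le> x"
proof -
  define m where "m = \<lfloor>log 2 x\<rfloor>"
  have m: "2 powr m \<le> x" "x < 2 powr (m + 1)"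
    using floor_log_eq_powr_iff[of x 2 m] assms by (auto simp: m_def)
  show thesis
  proof (cases "m < 0")
    case True
    \<comment> \<open>For \<open>m < 0\<close> the index is \<open>k = - m - 1\<close>; the shift
      makes \<open>k = 0\<close> the shell from 1/2 to 1.\<close>
    have eq: "- real (nat (- m - 1)) - 1 = real_of_int m" "- real (nat (- m - 1)) = real_of_int m + 1"
      using True by simp_all
    have "x < 1"
      using m(2) True powr_mono[of "real_of_int m + 1" 0 2] by simp
    then show thesis
      by (rule that(1)[rotated 2, of "nat (- m - 1)"]) (use m in \<open>simp_all only: eq of_int_add of_int_1 add_diff_cancel_right'\<close>)
  next
    case False
    have eq: "real (nat m) = real_of_int m"
      using False by simp
    have "1 \<le> x"
      using m(1) False ge_one_powr_ge_zero[of 2 "real_of_int m"] by simp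
    then show thesis
      by (rule that(2)[rotated 2, of "nat m"]) (use m eq in simp_all)
  qed
qed

text \<open>On each dyadic shell the function is bounded by a constant, and the shell lies in a ball
  of known volume. The resulting series are geometric, with ratio \<open>2 powr (2 * s - 2)\<close>
  near the origin and \<open>2 powr (- 2 * s)\<close> far away, both below 1 because
  \<open>0 < s < 1\<close>. This function is the common majorant for the second-difference kernels
  that follow.\<close>

lemma integrable_truncated_kernel:
  assumes s: "0 < s" "s < 1"
  shows "integrable lborel (\<lambda>h::'a::euclidean_space.
    min 1 ((norm h)\<^sup>2) / norm h powr (real DIM('a) + 2 * s))"
proof (rule integrableI_nonneg)
  define N where "N = real DIM('a)"
  define p where "p = N + 2 * s"
  define V where "V = unit_ball_vol N"
  have Np: "N > 0" "V \<ge> 0"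
    by (auto simp: N_def V_def)
  define f where "f h = min 1 ((norm h)\<^sup>2) / norm h powr p" for h :: 'a
  \<comment> \<open>\<open>a k\<close> bounds \<open>f\<close> on the shell from 2^(-k-1) to 2^(-k):
    outer radius in the numerator, inner radius in the denominator. \<open>b k\<close> does the same
    on the shell from 2^k to 2^(k+1), where the numerator is at most 1. \<open>A\<close> and
    \<open>B\<close> spread these bounds over full balls, which only enlarges the sum and makes the
    volumes explicit.\<close>
  define a where "a k = 2 powr (- 2 * real k + (real k + 1) * p)" for k
  define b where "b k = 2 powr (- real k * p)" for k
  define A where "A k h = ennreal (a k) * indicator (ball 0 (2 powr (- real k))) h" for k and h :: 'a
  define B where "B k h = ennreal (b k) * indicator (ball 0 (2 powr (real k + 1))) h" for k and h :: 'a
  have [measurable]: "A k \<in> borel_measurable lborel" "B k \<in> borel_measurable lborel" for k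
    unfolding A_def B_def
    by (auto intro!: borel_measurable_times_ennreal borel_measurable_indicator)
  have bound: "ennreal (f h) \<le> (\<Sum>k. A k h) + (\<Sum>k. B k h)" for h
  proof (cases "h = 0")
    case True
    then show ?thesis by (simp add: f_def)
  next
    case False
    then have "0 < norm h" by simp
    then show ?thesis
    proof (cases rule: dyadic_bracket)
      case (1 k)
      have "(norm h)\<^sup>2 \<le> (2 powr (- real k))\<^sup>2"
        by (rule power_mono) (use 1 in auto)
      also have "\<dots> = 2 powr (- 2 * real k)"
        by (simp add: power2_eq_square flip: powr_add)
      finally have sq: "(norm h)\<^sup>2 \<le> 2 powr (- 2 * real k)" .
      have "(2 powr (- real k - 1)) powr p \<le> norm h powr p"
        by (rule powr_mono2) (use 1 Np s in \<open>auto simp: p_def\<close>)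
      moreover have "(- real k - 1) * p = - (real k + 1) * p"
        by (simp add: algebra_simps)
      ultimately have den: "2 powr (- (real k + 1) * p) \<le> norm h powr p"
        by (metis powr_powr)
      have "f h \<le> 2 powr (- 2 * real k) / 2 powr (- (real k + 1) * p)"
        unfolding f_def by (rule frac_le) (use sq den in auto)
      also have "\<dots> = a k"
        by (simp add: a_def algebra_simps flip: powr_diff)
      finally have "ennreal (f h) \<le> A k h"
        using 1 by (simp add: A_def ennreal_leI)
      also have "A k h \<le> (\<Sum>k. A k h)"
        using sum_le_suminf[of "\<lambda>k. A k h" "{k}"] by simp
      finally show ?thesis
        by (simp add: add_increasing2)
    next
      case (2 k)
      have "(2 powr (real k)) powr p \<le> norm h powr p"
        by (rule powr_mono2) (use 2 Np s in \<open>auto simp: p_def\<close>)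
      then have den: "2 powr (real k * p) \<le> norm h powr p"
        by (simp add: powr_powr)
      have "f h \<le> 1 / 2 powr (real k * p)"
        unfolding f_def by (rule frac_le) (use den in auto)
      also have "\<dots> = b k"
        by (simp add: b_def powr_minus_divide)
      finally have "ennreal (f h) \<le> B k h"
        using 2 by (simp add: B_def ennreal_leI)
      also have "B k h \<le> (\<Sum>k. B k h)"
        using sum_le_suminf[of "\<lambda>k. B k h" "{k}"] by simp
      finally show ?thesis
        by (simp add: add_increasing)
    qed
  qed
  have powN: "(2 powr t) ^ DIM('a) = 2 powr (t * N)" for t :: real
    by (simp add: N_def powr_powr flip: powr_realpow)
  have intA: "(\<integral>\<^sup>+h. A k h \<partial>lborel) = ennreal (V * 2 powr p * (2 powr (2 * s - 2)) ^ k)" for k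
  proof -
    have "(\<integral>\<^sup>+h. A k h \<partial>lborel) = ennreal (a k) * emeasure lborel (ball (0::'a) (2 powr (- real k)))"
      unfolding A_def by (simp add: nn_integral_cmult_indicator)
    also have "\<dots> = ennreal (a k) * ennreal (V * 2 powr (- real k * N))"
      using emeasure_ball[of "2 powr (- real k)" "0::'a"] powN[of "- real k"] by (simp add: V_def N_def)
    also have "\<dots> = ennreal (V * (a k * 2 powr (- real k * N)))"
      by (simp add: a_def Np ac_simps flip: ennreal_mult)
    also have "a k * 2 powr (- real k * N) = 2 powr p * (2 powr (2 * s - 2)) ^ k"
      by (simp add: a_def powr_powr p_def algebra_simps flip: powr_add powr_realpow)
    finally show ?thesis by (simp add: ac_simps)
  qed
  have intB: "(\<integral>\<^sup>+h. B k h \<partial>lborel) = ennreal (V * 2 powr N * (2 powr (- 2 * s)) ^ k)" for k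
  proof -
    have "(\<integral>\<^sup>+h. B k h \<partial>lborel) = ennreal (b k) * emeasure lborel (ball (0::'a) (2 powr (real k + 1)))"
      unfolding B_def by (simp add: nn_integral_cmult_indicator)
    also have "\<dots> = ennreal (b k) * ennreal (V * 2 powr ((real k + 1) * N))"
      using emeasure_ball[of "2 powr (real k + 1)" "0::'a"] powN[of "real k + 1"] by (simp add: V_def N_def)
    also have "\<dots> = ennreal (V * (b k * 2 powr ((real k + 1) * N)))"
      by (simp add: b_def Np ac_simps flip: ennreal_mult)
    also have "b k * 2 powr ((real k + 1) * N) = 2 powr N * (2 powr (- 2 * s)) ^ k"
      by (simp add: b_def powr_powr p_def algebra_simps flip: powr_add powr_realpow)
    finally show ?thesis by (simp add: ac_simps)
  qed
  have lt1: "2 powr (2 * s - 2) < 1" "2 powr (- 2 * s) < 1"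
    using powr_less_mono[of "2 * s - 2" 0 2] powr_less_mono[of "- 2 * s" 0 2] s by auto
  have geo: "(\<Sum>k. ennreal (c * x ^ k)) < \<infinity>" if "0 \<le> c" "0 \<le> x" "x < 1" for c x :: real
  proof -
    have "summable (\<lambda>k. c * x ^ k)"
      using that by (intro summable_mult summable_geometric) auto
    then have "(\<Sum>k. ennreal (c * x ^ k)) = ennreal (\<Sum>k. c * x ^ k)"
      using that by (intro suminf_ennreal2) auto
    then show ?thesis
      by (simp only: ennreal_less_top infinity_ennreal_def)
  qed
  have "(\<integral>\<^sup>+h. ennreal (f h) \<partial>lborel) \<le> (\<integral>\<^sup>+h. (\<Sum>k. A k h) + (\<Sum>k. B k h) \<partial>lborel)"
    by (intro nn_integral_mono bound)
  also have "\<dots> = (\<Sum>k. \<integral>\<^sup>+h. A k h \<partial>lborel) + (\<Sum>k. \<integral>\<^sup>+h. B k h \<partial>lborel)"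
    by (simp add: nn_integral_add nn_integral_suminf)
  also have "\<dots> < \<infinity>"
    unfolding intA intB infinity_ennreal_def ennreal_add_less_top
    using lt1 Np by (intro conjI geo[unfolded infinity_ennreal_def]) simp_all
  finally show "(\<integral>\<^sup>+h. ennreal (min 1 ((norm h)\<^sup>2) / norm (h::'a) powr (real DIM('a) + 2 * s)) \<partial>lborel) < \<infinity>"
    by (simp add: f_def p_def N_def)
qed auto

section \<open>Taylor estimates with constants uniform on a ball\<close>

lemma frechet_derivative_eq_sum_d1:
  assumes "f differentiable (at x)"
  shows "frechet_derivative f (at x) v = (\<Sum>b\<in>Basis. (v \<bullet> b) * d1 f b x)"
proof -
  have "linear (frechet_derivative f (at x))"
    using assms linear_frechet_derivative by blast
  then have "frechet_derivative f (at x) (\<Sum>b\<in>Basis. (v \<bullet> b) *\<^sub>R b)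
      = (\<Sum>b\<in>Basis. (v \<bullet> b) * frechet_derivative f (at x) b)"
    by (simp add: linear_sum linear_scale)
  then show ?thesis
    by (simp add: euclidean_representation d1_def)
qed

text \<open>The second partial derivatives are continuous, hence bounded on the compact ball, and
  the mean value inequality on this convex set turns the bound into a Lipschitz constant.\<close>

lemma d1_Lipschitz:
  fixes f :: "'a::euclidean_space \<Rightarrow> real"
  assumes C2: "C2_on S f" and sub: "cball z \<tau> \<subseteq> S"
  obtains L where "0 \<le> L" "\<And>x y b. x \<in> cball z \<tau> \<Longrightarrow> y \<in> cball z \<tau> \<Longrightarrow> b \<in> Basis \<Longrightarrow>
    \<bar>d1 f b x - d1 f b y\<bar> \<le> L * norm (x - y)"
proof -
  \<comment> \<open>Summing over both indices yields one \<open>L\<close> that serves all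
    coordinates \<open>b\<close> at once and dominates the operator norm of the derivative of each
    \<open>d1 f b\<close>.\<close>
  define T where "T x = (\<Sum>b\<in>Basis. \<Sum>c\<in>Basis. \<bar>d2 f b c x\<bar>)" for x
  have "continuous_on (cball z \<tau>) T"
    unfolding T_def using C2 sub
    by (intro continuous_intros) (meson C2_on_def continuous_on_subset)
  then have "bounded (T ` cball z \<tau>)"
    by (simp add: compact_continuous_image compact_imp_bounded)
  then obtain L where L: "0 < L" "\<And>x. x \<in> cball z \<tau> \<Longrightarrow> \<bar>T x\<bar> \<le> L"
    unfolding bounded_pos by auto
  have "\<bar>d1 f b x - d1 f b y\<bar> \<le> L * norm (x - y)"
    if "x \<in> cball z \<tau>" "y \<in> cball z \<tau>" and b: "b \<in> Basis" for x y b
  proof -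
    have "norm (d1 f b x - d1 f b y) \<le> L * norm (x - y)"
    proof (rule differentiable_bound[where S = "cball z \<tau>"])
      show "(d1 f b has_derivative frechet_derivative (d1 f b) (at w)) (at w within cball z \<tau>)"
        if "w \<in> cball z \<tau>" for w
        using C2 sub that b unfolding C2_on_def
        by (meson frechet_derivative_works has_derivative_at_withinI subsetD)
      show "onorm (frechet_derivative (d1 f b) (at w)) \<le> L" if w: "w \<in> cball z \<tau>" for w
      proof (rule onorm_le)
        fix v :: 'a
        have "d1 f b differentiable (at w)"
          using C2 sub w b unfolding C2_on_def by blast
        then have "frechet_derivative (d1 f b) (at w) v = (\<Sum>c\<in>Basis. (v \<bullet> c) * d2 f b c w)"
          using frechet_derivative_eq_sum_d1[of "d1 f b" w v] by (simp add: d2_def d1_def[of "d1 f b"])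
        then have "norm (frechet_derivative (d1 f b) (at w) v) \<le> (\<Sum>c\<in>Basis. \<bar>(v \<bullet> c) * d2 f b c w\<bar>)"
          by (simp add: sum_abs)
        also have "\<dots> \<le> (\<Sum>c\<in>Basis. norm v * \<bar>d2 f b c w\<bar>)"
          by (intro sum_mono) (auto simp: abs_mult Basis_le_norm intro: mult_right_mono)
        also have "\<dots> = (\<Sum>c\<in>Basis. \<bar>d2 f b c w\<bar>) * norm v"
          by (simp add: sum_distrib_left mult.commute)
        also have "\<dots> \<le> T w * norm v"
          unfolding T_def using member_le_sum[OF b, of "\<lambda>b. \<Sum>c\<in>Basis. \<bar>d2 f b c w\<bar>"]
          by (intro mult_right_mono) (auto simp: sum_nonneg)
        also have "\<dots> \<le> L * norm v"
          using L(2)[OF w] by (intro mult_right_mono) auto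
        finally show "norm (frechet_derivative (d1 f b) (at w) v) \<le> L * norm v" .
      qed
    qed (use that in auto)
    then show ?thesis by simp
  qed
  with L(1) show thesis
    by (intro that[of L]) auto
qed

text \<open>The mean value inequality is applied to the linearization error: along the segment from
  \<open>x\<close> to \<open>y\<close> the derivative differs from the one at \<open>x\<close> by at
  most a multiple of \<open>norm (y - x)\<close>. That \<open>M\<close> is independent of the base
  point \<open>x\<close> makes the later bounds locally uniform.\<close>

lemma C2_Taylor:
  fixes f :: "'a::euclidean_space \<Rightarrow> real"
  assumes C2: "C2_on S f" and sub: "cball z \<tau> \<subseteq> S"
  obtains M where "0 \<le> M" "\<And>x y. x \<in> cball z \<tau> \<Longrightarrow> y \<in> cball z \<tau> \<Longrightarrow>
    \<bar>f y - f x - frechet_derivative f (at x) (y - x)\<bar> \<le> M * (norm (y - x))\<^sup>2"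
proof -
  obtain L where L: "0 \<le> L" "\<And>x y b. x \<in> cball z \<tau> \<Longrightarrow> y \<in> cball z \<tau> \<Longrightarrow> b \<in> Basis \<Longrightarrow>
    \<bar>d1 f b x - d1 f b y\<bar> \<le> L * norm (x - y)"
    using d1_Lipschitz[OF C2 sub] by blast
  define M where "M = DIM('a) * L"
  have diff: "f differentiable (at w)" if "w \<in> cball z \<tau>" for w
    using C2 sub that unfolding C2_on_def by blast
  have "\<bar>f y - f x - frechet_derivative f (at x) (y - x)\<bar> \<le> M * (norm (y - x))\<^sup>2"
    if x: "x \<in> cball z \<tau>" and y: "y \<in> cball z \<tau>" for x y
  proof -
    have seg: "closed_segment x y \<subseteq> cball z \<tau>"
      using x y by (simp add: closed_segment_subset)
    have "norm (f y - f x - frechet_derivative f (at x) (y - x)) \<le> norm (y - x) * (M * norm (y - x))"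
    proof (rule differentiable_bound_linearization[where S = "closed_segment x y"])
      show "x + t *\<^sub>R (y - x) \<in> closed_segment x y" if "t \<in> {0..1}" for t
        using that by (auto simp: in_segment algebra_simps intro!: exI[of _ t])
      show "(f has_derivative frechet_derivative f (at w)) (at w within closed_segment x y)"
        if "w \<in> closed_segment x y" for w
        using diff seg that by (meson frechet_derivative_works has_derivative_at_withinI subsetD)
      show "onorm (frechet_derivative f (at w) - frechet_derivative f (at x)) \<le> M * norm (y - x)"
        if w: "w \<in> closed_segment x y" for w
      proof (rule onorm_le)
        fix v :: 'a
        have wx: "norm (w - x) \<le> norm (y - x)"
          using segment_bound(1)[OF w] by (simp add: norm_minus_commute)
        have "norm ((frechet_derivative f (at w) - frechet_derivative f (at x)) v)
          = \<bar>\<Sum>b\<in>Basis. (v \<bullet> b) * (d1 f b w - d1 f b x)\<bar>"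
          using diff x w seg
          by (simp add: frechet_derivative_eq_sum_d1 subset_iff right_diff_distrib sum_subtractf)
        also have "\<dots> \<le> (\<Sum>b\<in>Basis. \<bar>(v \<bullet> b) * (d1 f b w - d1 f b x)\<bar>)"
          by (rule sum_abs)
        also have "\<dots> \<le> (\<Sum>b\<in>(Basis::'a set). norm v * (L * norm (y - x)))"
        proof (rule sum_mono)
          fix b :: 'a assume b: "b \<in> Basis"
          have "\<bar>d1 f b w - d1 f b x\<bar> \<le> L * norm (w - x)"
            using L(2)[of w x b] w seg x b by blast
          also have "\<dots> \<le> L * norm (y - x)"
            using wx L(1) by (rule mult_left_mono)
          finally show "\<bar>(v \<bullet> b) * (d1 f b w - d1 f b x)\<bar> \<le> norm v * (L * norm (y - x))"
            unfolding abs_mult by (intro mult_mono) (auto simp: Basis_le_norm b)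
        qed
        also have "\<dots> = M * norm (y - x) * norm v"
          by (simp add: M_def)
        finally show "norm ((frechet_derivative f (at w) - frechet_derivative f (at x)) v) \<le> M * norm (y - x) * norm v" .
      qed
    qed auto
    then show ?thesis
      by (simp add: power2_eq_square ac_simps)
  qed
  moreover have "0 \<le> M" using L by (simp add: M_def)
  ultimately show thesis using that by blast
qed

section \<open>The fractional Laplacian as an absolutely convergent integral\<close>

text \<open>The principal value after averaging \<open>h\<close> with \<open>- h\<close>: the
  first-order terms cancel, which makes the integral converge absolutely where \<open>u\<close> is
  bounded and twice continuously differentiable nearby. The factor 1/2 comes from the averaging; the
  normalizing constant \<open>frac_const\<close> is kept outside.\<close>

definition sym_frac :: "real \<Rightarrow> ('a::euclidean_space \<Rightarrow> real) \<Rightarrow> 'a \<Rightarrow> real" where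
  "sym_frac s u x = (LINT h|lborel.
     (2 * u x - u (x + h) - u (x - h)) / norm h powr (real DIM('a) + 2 * s)) / 2"

text \<open>For small \<open>h\<close> the linear terms cancel and Taylor's bound leaves a multiple
  of |h|^2; for larger \<open>h\<close> boundedness of \<open>u\<close> suffices. The constant is
  uniform for \<open>x\<close> near \<open>z\<close>, as dominated convergence requires.\<close>

lemma second_difference_bound:
  fixes u :: "'a::euclidean_space \<Rightarrow> real"
  assumes \<Omega>: "open \<Omega>" "C2_on \<Omega> u" "bounded (range u)" "z \<in> \<Omega>"
  obtains \<delta> M where "0 < \<delta>" "0 \<le> M" "cball z \<delta> \<subseteq> \<Omega>"
    "\<And>x h. x \<in> cball z \<delta> \<Longrightarrow> \<bar>2 * u x - u (x + h) - u (x - h)\<bar> \<le> M * min 1 ((norm h)\<^sup>2)"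
proof -
  obtain e where e: "0 < e" "cball z e \<subseteq> \<Omega>"
    using \<Omega> open_contains_cball by blast
  obtain M where M: "0 \<le> M" "\<And>x y. x \<in> cball z e \<Longrightarrow> y \<in> cball z e \<Longrightarrow>
      \<bar>u y - u x - frechet_derivative u (at x) (y - x)\<bar> \<le> M * (norm (y - x))\<^sup>2"
    using C2_Taylor[OF \<Omega>(2) e(2)] by blast
  obtain B where B: "0 < B" "\<And>x. \<bar>u x\<bar> \<le> B"
    using \<Omega>(3) unfolding bounded_pos by auto
  \<comment> \<open>Half the radius keeps \<open>x + h\<close> and \<open>x - h\<close> in
    \<open>cball z e\<close> for \<open>norm h \<le> \<delta>\<close>. The cap at 1 gives
    \<open>4 * B \<le> 4 * B / \<delta>\<^sup>2\<close>, so that the single constant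
    \<open>K\<close> covers both branches of the minimum.\<close>
  define \<delta> where "\<delta> = min 1 (e / 2)"
  have \<delta>: "0 < \<delta>" "\<delta> \<le> 1" "2 * \<delta> \<le> e"
    using e by (auto simp: \<delta>_def)
  define K where "K = 2 * M + 4 * B / \<delta>\<^sup>2"
  have K: "K \<ge> 2 * M" "K \<ge> 4 * B / \<delta>\<^sup>2" "K \<ge> 0"
    using M B \<delta> by (auto simp: K_def)
  have "4 * B \<le> 4 * B / \<delta>\<^sup>2"
    using B \<delta> by (simp add: le_divide_eq power_le_one)
  then have K4: "4 * B \<le> K"
    using K by linarith
  have "\<bar>2 * u x - u (x + h) - u (x - h)\<bar> \<le> K * min 1 ((norm h)\<^sup>2)" if x: "x \<in> cball z \<delta>" for x h
  proof -
    have "\<bar>2 * u x - u (x + h) - u (x - h)\<bar> \<le> 4 * B"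
      using B(2)[of x] B(2)[of "x + h"] B(2)[of "x - h"] by linarith
    then have 1: "\<bar>2 * u x - u (x + h) - u (x - h)\<bar> \<le> K"
      using K4 by linarith
    have 2: "\<bar>2 * u x - u (x + h) - u (x - h)\<bar> \<le> K * (norm h)\<^sup>2"
    proof (cases "norm h \<le> \<delta>")
      case True
      have xe: "x \<in> cball z e"
        using x \<delta> by (auto simp: dist_norm)
      have "norm (z - (x + h)) \<le> norm (z - x) + norm h" "norm (z - (x - h)) \<le> norm (z - x) + norm h"
        using norm_triangle_ineq4[of "z - x" h] norm_triangle_ineq[of "z - x" h]
        by (simp_all add: algebra_simps)
      then have "x + h \<in> cball z e" "x - h \<in> cball z e"
        using x \<delta> True by (auto simp: dist_norm)
      then have *: "\<bar>u (x + h) - u x - frechet_derivative u (at x) h\<bar> \<le> M * (norm h)\<^sup>2"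
           "\<bar>u (x - h) - u x - frechet_derivative u (at x) (- h)\<bar> \<le> M * (norm h)\<^sup>2"
        using M(2)[OF xe, of "x + h"] M(2)[OF xe, of "x - h"] by auto
      have "u differentiable (at x)"
        using \<Omega>(2) e(2) xe unfolding C2_on_def by blast
      then have "frechet_derivative u (at x) (- h) = - frechet_derivative u (at x) h"
        using linear_frechet_derivative linear_neg by blast
      with * have "\<bar>2 * u x - u (x + h) - u (x - h)\<bar> \<le> 2 * M * (norm h)\<^sup>2"
        by linarith
      also have "\<dots> \<le> K * (norm h)\<^sup>2"
        using K by (intro mult_right_mono) auto
      finally show ?thesis .
    next
      case False
      have "\<delta>\<^sup>2 \<le> (norm h)\<^sup>2"
        using False \<delta> by (intro power_mono) auto
      have "4 * B = 4 * B / \<delta>\<^sup>2 * \<delta>\<^sup>2"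
        using \<delta> by simp
      also have "\<dots> \<le> K * (norm h)\<^sup>2"
        using K B \<open>\<delta>\<^sup>2 \<le> (norm h)\<^sup>2\<close> by (intro mult_mono) auto
      finally show ?thesis
        using \<open>\<bar>2 * u x - u (x + h) - u (x - h)\<bar> \<le> 4 * B\<close> by linarith
    qed
    from 1 2 show ?thesis
      by (simp add: min_def)
  qed
  moreover have "cball z \<delta> \<subseteq> \<Omega>"
    using e(2) \<delta> by (intro order_trans[OF _ e(2)]) (auto simp: subset_cball)
  ultimately show thesis
    using that \<delta>(1) K(3) by blast
qed

lemma borel_measurable_sym_kernel:
  fixes u :: "'a::euclidean_space \<Rightarrow> real"
  assumes "continuous_on UNIV u"
  shows "(\<lambda>h. (2 * u x - u (x + h) - u (x - h)) / norm h powr p) \<in> borel_measurable borel"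
proof -
  have [measurable]: "(\<lambda>h. 2 * u x - u (x + h) - u (x - h)) \<in> borel_measurable borel"
    by (intro borel_measurable_continuous_onI continuous_intros continuous_on_compose2[OF assms]) auto
  show ?thesis by measurable
qed

lemma sym_kernel_le:
  fixes h :: "'a::euclidean_space"
  assumes "a \<le> M * min 1 ((norm h)\<^sup>2)"
  shows "a / norm h powr p \<le> M * (min 1 ((norm h)\<^sup>2) / norm h powr p)"
  using divide_right_mono[OF assms, of "norm h powr p"] by simp

lemma integrable_sym_kernel:
  fixes u :: "'a::euclidean_space \<Rightarrow> real"
  assumes s: "0 < s" "s < 1" and u: "continuous_on UNIV u"
    and \<Omega>: "open \<Omega>" "C2_on \<Omega> u" "bounded (range u)" "x \<in> \<Omega>"
  shows "integrable lborel (\<lambda>h. (2 * u x - u (x + h) - u (x - h)) / norm h powr (real DIM('a) + 2 * s))"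
proof -
  obtain \<delta> M where M: "0 < \<delta>"
    "\<And>x' h. x' \<in> cball x \<delta> \<Longrightarrow> \<bar>2 * u x' - u (x' + h) - u (x' - h)\<bar> \<le> M * min 1 ((norm h)\<^sup>2)"
    by (rule second_difference_bound[OF \<Omega>]) blast
  show ?thesis
  proof (rule Bochner_Integration.integrable_bound)
    show "integrable lborel (\<lambda>h::'a. M * (min 1 ((norm h)\<^sup>2) / norm h powr (real DIM('a) + 2 * s)))"
      using integrable_truncated_kernel[OF s] by (rule integrable_mult_right)
    show "AE h in lborel. norm ((2 * u x - u (x + h) - u (x - h)) / norm h powr (real DIM('a) + 2 * s))
        \<le> norm (M * (min 1 ((norm h)\<^sup>2) / norm h powr (real DIM('a) + 2 * s)))"
    proof (intro AE_I2)
      fix h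
      have "\<bar>2 * u x - u (x + h) - u (x - h)\<bar> / norm h powr (real DIM('a) + 2 * s)
         \<le> M * (min 1 ((norm h)\<^sup>2) / norm h powr (real DIM('a) + 2 * s))"
        using M by (intro sym_kernel_le) auto
      also have "\<dots> \<le> norm (M * (min 1 ((norm h)\<^sup>2) / norm h powr (real DIM('a) + 2 * s)))"
        by (simp only: real_norm_def abs_ge_self)
      finally show "norm ((2 * u x - u (x + h) - u (x - h)) / norm h powr (real DIM('a) + 2 * s))
        \<le> norm (M * (min 1 ((norm h)\<^sup>2) / norm h powr (real DIM('a) + 2 * s)))"
        by simp
    qed
  qed (use borel_measurable_sym_kernel[OF u] in simp)
qed

text \<open>Dominated convergence along sequences, with a multiple of the truncated kernel as
  majorant near each point. This continuity later turns an inequality almost everywhere into one at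
  every point.\<close>

lemma continuous_on_sym_frac:
  fixes u :: "'a::euclidean_space \<Rightarrow> real"
  assumes s: "0 < s" "s < 1" and u: "continuous_on UNIV u"
    and \<Omega>: "open \<Omega>" "C2_on \<Omega> u" "bounded (range u)"
  shows "continuous_on \<Omega> (sym_frac s u)"
proof -
  define p where "p = real DIM('a) + 2 * s"
  have "isCont (sym_frac s u) z" if z: "z \<in> \<Omega>" for z
  proof -
    obtain \<delta> M where M: "0 < \<delta>"
      "\<And>x h. x \<in> cball z \<delta> \<Longrightarrow> \<bar>2 * u x - u (x + h) - u (x - h)\<bar> \<le> M * min 1 ((norm h)\<^sup>2)"
      by (rule second_difference_bound[OF \<Omega> z]) blast
    have "(\<lambda>n. LINT h|lborel. (2 * u (X n) - u (X n + h) - u (X n - h)) / norm h powr p)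
        \<longlonglongrightarrow> (LINT h|lborel. (2 * u z - u (z + h) - u (z - h)) / norm h powr p)"
      if X: "X \<longlonglongrightarrow> z" for X
    proof -
      \<comment> \<open>Discarding the first \<open>n0\<close> terms leaves only points for which
        the local majorant is valid.\<close>
      have "eventually (\<lambda>n. X n \<in> cball z \<delta>) sequentially"
        using tendstoD[OF X M(1)] by eventually_elim (simp add: dist_commute)
      then obtain n0 where n0: "\<And>n. n \<ge> n0 \<Longrightarrow> X n \<in> cball z \<delta>"
        by (auto simp: eventually_sequentially)
      have ucont: "isCont u w" for w
        using u by (simp add: continuous_on_eq_continuous_at)
      have "(\<lambda>n. LINT h|lborel. (2 * u (X (n + n0)) - u (X (n + n0) + h) - u (X (n + n0) - h)) / norm h powr p)
        \<longlonglongrightarrow> (LINT h|lborel. (2 * u z - u (z + h) - u (z - h)) / norm h powr p)"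
      proof (rule integral_dominated_convergence[where
            w = "\<lambda>h. M * (min 1 ((norm h)\<^sup>2) / norm h powr p)"])
        show "integrable lborel (\<lambda>h::'a. M * (min 1 ((norm h)\<^sup>2) / norm h powr p))"
          unfolding p_def using integrable_truncated_kernel[OF s] by (rule integrable_mult_right)
        show "AE h in lborel. (\<lambda>n. (2 * u (X (n + n0)) - u (X (n + n0) + h) - u (X (n + n0) - h)) / norm h powr p)
           \<longlonglongrightarrow> (2 * u z - u (z + h) - u (z - h)) / norm h powr p"
        proof (intro AE_I2)
          fix h :: 'a
          have X': "(\<lambda>n. X (n + n0)) \<longlonglongrightarrow> z"
            using X by (rule LIMSEQ_ignore_initial_segment)
          have "(\<lambda>n. 2 * u (X (n + n0)) - u (X (n + n0) + h) - u (X (n + n0) - h))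
             \<longlonglongrightarrow> 2 * u z - u (z + h) - u (z - h)"
            by (intro tendsto_intros isCont_tendsto_compose[OF ucont] X')
          then show "(\<lambda>n. (2 * u (X (n + n0)) - u (X (n + n0) + h) - u (X (n + n0) - h)) / norm h powr p)
             \<longlonglongrightarrow> (2 * u z - u (z + h) - u (z - h)) / norm h powr p"
            unfolding divide_inverse by (rule tendsto_mult_right)
        qed
        show "AE h in lborel. norm ((2 * u (X (n + n0)) - u (X (n + n0) + h) - u (X (n + n0) - h)) / norm h powr p)
            \<le> M * (min 1 ((norm h)\<^sup>2) / norm h powr p)" for n
        proof (intro AE_I2)
          fix h
          have "\<bar>2 * u (X (n + n0)) - u (X (n + n0) + h) - u (X (n + n0) - h)\<bar> / norm h powr p
              \<le> M * (min 1 ((norm h)\<^sup>2) / norm h powr p)"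
            using M(2) n0 by (intro sym_kernel_le) auto
          then show "norm ((2 * u (X (n + n0)) - u (X (n + n0) + h) - u (X (n + n0) - h)) / norm h powr p)
            \<le> M * (min 1 ((norm h)\<^sup>2) / norm h powr p)"
            by simp
        qed
      qed (use borel_measurable_sym_kernel[OF u] in simp_all)
      then show ?thesis
        by (rule LIMSEQ_offset)
    qed
    then show ?thesis
      unfolding continuous_at_sequentially sym_frac_def comp_def p_def
      by (intro allI impI tendsto_divide) auto
  qed
  then show ?thesis
    by (simp add: continuous_at_imp_continuous_on)
qed

lemma integral_lborel_translate:
  fixes f :: "'a::euclidean_space \<Rightarrow> real"
  assumes f: "f \<in> borel_measurable borel"
  shows "(LINT y|lborel. f y) = (LINT h|lborel. f (x + h))"
  using integral_distr[of "(+) x" lborel borel f] f by (simp add: lborel_distr_plus)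

lemma integral_lborel_reflect:
  fixes f :: "'a::euclidean_space \<Rightarrow> real"
  assumes f: "f \<in> borel_measurable borel"
  shows "(LINT h|lborel. f (- h)) = (LINT h|lborel. f h)"
    and "integrable lborel (\<lambda>h. f (- h)) \<longleftrightarrow> integrable lborel f"
proof -
  have "distr lborel borel (uminus :: 'a \<Rightarrow> 'a) = lborel"
    using lborel_affine[of "-1" "0::'a"] by (simp add: density_1)
  then show "(LINT h|lborel. f (- h)) = (LINT h|lborel. f h)"
    and "integrable lborel (\<lambda>h. f (- h)) \<longleftrightarrow> integrable lborel f"
    using integral_distr[of uminus lborel borel f] integrable_distr_eq[of uminus lborel borel f] f
    by simp_all
qed

text \<open>Off \<open>ball x \<epsilon>\<close> the one-sided difference kernel is integrable by
  itself, so translating it and averaging with its reflection is legitimate. The radius then tends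
  to 0 by dominated convergence, with the absolute value of the full second-difference kernel as
  majorant.\<close>

lemma frac_lap_eq_sym_frac:
  fixes u :: "'a::euclidean_space \<Rightarrow> real"
  assumes s: "0 < s" "s < 1" and u: "continuous_on UNIV u"
    and \<Omega>: "open \<Omega>" "C2_on \<Omega> u" "bounded (range u)" and x: "x \<in> \<Omega>"
  shows "frac_lap s u x = frac_const DIM('a) s * sym_frac s u x"
proof -
  define p where "p = real DIM('a) + 2 * s"
  have p: "p > 0"
    using s by (simp add: p_def add_pos_pos)
  define K where "K h = (2 * u x - u (x + h) - u (x - h)) / norm h powr p" for h
  have K: "integrable lborel K"
    unfolding K_def p_def by (rule integrable_sym_kernel[OF s u \<Omega> x])
  obtain B where B: "0 < B" "\<And>x. \<bar>u x\<bar> \<le> B"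
    using \<Omega>(3) unfolding bounded_pos by auto
  have [measurable]: "u \<in> borel_measurable borel"
    using u by (rule borel_measurable_continuous_onI)
  \<comment> \<open>With \<open>\<epsilon> < 1\<close>, both 1 and |h|^2 are at least \<epsilon>^2
    off the excluded ball, so the truncated kernel times \<open>2 * B / \<epsilon>\<^sup>2\<close>
    is a majorant. Only small radii matter for the limit.\<close>
  have trunc: "(LINT y : - ball x \<epsilon> | lborel. (u x - u y) / dist x y powr p)
      = (LINT h|lborel. indicator (- ball 0 \<epsilon>) h * K h) / 2"
    if \<epsilon>: "0 < \<epsilon>" "\<epsilon> < 1" for \<epsilon>
  proof -
    define f where "f h = indicator (- ball 0 \<epsilon>) h * ((u x - u (x + h)) / norm h powr p)" for h
    have fm [measurable]: "f \<in> borel_measurable borel"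
      unfolding f_def by measurable
    have int: "integrable lborel f"
    proof (rule Bochner_Integration.integrable_bound)
      show "integrable lborel (\<lambda>h::'a. (2 * B / \<epsilon>\<^sup>2) * (min 1 ((norm h)\<^sup>2) / norm h powr p))"
        unfolding p_def using integrable_truncated_kernel[OF s] by (rule integrable_mult_right)
      show "AE h in lborel. norm (f h) \<le> norm ((2 * B / \<epsilon>\<^sup>2) * (min 1 ((norm h)\<^sup>2) / norm h powr p))"
      proof (intro AE_I2)
        fix h :: 'a
        show "norm (f h) \<le> norm ((2 * B / \<epsilon>\<^sup>2) * (min 1 ((norm h)\<^sup>2) / norm h powr p))"
        proof (cases "norm h < \<epsilon>")
          case True
          then show ?thesis by (simp add: f_def)
        next
          case False
          have "\<epsilon>\<^sup>2 \<le> (norm h)\<^sup>2" "\<epsilon>\<^sup>2 \<le> 1"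
            using False \<epsilon> by (auto intro: power_mono power_le_one)
          then have m: "\<epsilon>\<^sup>2 \<le> min 1 ((norm h)\<^sup>2)"
            by simp
          have "\<bar>u x - u (x + h)\<bar> \<le> 2 * B"
            using B(2)[of x] B(2)[of "x + h"] by linarith
          also have "\<dots> = 2 * B / \<epsilon>\<^sup>2 * \<epsilon>\<^sup>2"
            using \<epsilon> by simp
          also have "\<dots> \<le> 2 * B / \<epsilon>\<^sup>2 * min 1 ((norm h)\<^sup>2)"
            using m B \<epsilon> by (intro mult_left_mono) auto
          finally have "\<bar>u x - u (x + h)\<bar> / norm h powr p \<le> 2 * B / \<epsilon>\<^sup>2 * (min 1 ((norm h)\<^sup>2) / norm h powr p)"
            by (rule sym_kernel_le)
          moreover have "norm (f h) = \<bar>u x - u (x + h)\<bar> / norm h powr p"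
            using False by (simp add: f_def)
          ultimately show ?thesis
            by (metis abs_ge_self order_trans real_norm_def)
        qed
      qed
    qed simp
    have int': "integrable lborel (\<lambda>h. f (- h))"
      using integral_lborel_reflect(2)[OF fm] int by simp
    have "(LINT y : - ball x \<epsilon> | lborel. (u x - u y) / dist x y powr p)
      = (LINT y|lborel. indicator (- ball x \<epsilon>) y * ((u x - u y) / dist x y powr p))"
      by (simp add: set_lebesgue_integral_def)
    also have "\<dots> = (LINT h|lborel. indicator (- ball x \<epsilon>) (x + h) * ((u x - u (x + h)) / dist x (x + h) powr p))"
      by (rule integral_lborel_translate) measurable
    also have "\<dots> = (LINT h|lborel. f h)"
      by (simp add: f_def indicator_def dist_norm)
    finally have 1: "(LINT y : - ball x \<epsilon> | lborel. (u x - u y) / dist x y powr p) = (LINT h|lborel. f h)" .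
    \<comment> \<open>The excluded ball is symmetric about the origin, so adding the reflected
      integrand to \<open>f\<close> yields exactly the second difference on its complement.\<close>
    have "2 * (LINT h|lborel. f h) = (LINT h|lborel. f h) + (LINT h|lborel. f (- h))"
      using integral_lborel_reflect(1)[OF fm] by simp
    also have "\<dots> = (LINT h|lborel. f h + f (- h))"
      using int int' by simp
    also have "(\<lambda>h. f h + f (- h)) = (\<lambda>h. indicator (- ball 0 \<epsilon>) h * K h)"
      by (auto simp: f_def K_def indicator_def add_divide_distrib diff_divide_distrib)
    finally show ?thesis
      using 1 by simp
  qed
  have "((\<lambda>\<epsilon>. LINT h|lborel. indicator (- ball 0 \<epsilon>) h * K h) \<longlongrightarrow> (LINT h|lborel. K h)) (at_right 0)"
  proof (rule tendsto_at_right_sequentially[of 0 1])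
    fix S :: "nat \<Rightarrow> real"
    assume S: "\<And>n. 0 < S n" "S \<longlonglongrightarrow> 0"
    show "(\<lambda>n. LINT h|lborel. indicator (- ball 0 (S n)) h * K h) \<longlonglongrightarrow> (LINT h|lborel. K h)"
    proof (rule integral_dominated_convergence[where w = "\<lambda>h. \<bar>K h\<bar>"])
      show "AE h in lborel. (\<lambda>n. indicator (- ball 0 (S n)) h * K h) \<longlonglongrightarrow> K h"
      proof (intro AE_I2)
        fix h :: 'a
        \<comment> \<open>At \<open>h = 0\<close> every indicator vanishes, but so does the
          numerator of \<open>K\<close>; elsewhere the sequence is eventually constant.\<close>
        show "(\<lambda>n. indicator (- ball 0 (S n)) h * K h) \<longlonglongrightarrow> K h"
        proof (cases "h = 0")
          case True
          then show ?thesis by (simp add: K_def)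
        next
          case False
          then have "eventually (\<lambda>n. S n < norm h) sequentially"
            using S(2) by (simp add: order_tendstoD)
          then have "eventually (\<lambda>n. indicator (- ball 0 (S n)) h * K h = K h) sequentially"
            by eventually_elim simp
          then show ?thesis
            by (rule tendsto_eventually)
        qed
      qed
      show "AE h in lborel. norm (indicator (- ball 0 (S n)) h * K h) \<le> \<bar>K h\<bar>" for n
        by (intro AE_I2) (simp add: indicator_def)
    qed (use K in auto)
  qed simp
  then have "((\<lambda>\<epsilon>. (LINT h|lborel. indicator (- ball 0 \<epsilon>) h * K h) / 2) \<longlongrightarrow> sym_frac s u x) (at_right 0)"
    unfolding sym_frac_def K_def p_def by (rule tendsto_divide) auto
  moreover have "eventually (\<lambda>\<epsilon>. (LINT h|lborel. indicator (- ball 0 \<epsilon>) h * K h) / 2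
      = (LINT y : - ball x \<epsilon> | lborel. (u x - u y) / dist x y powr p)) (at_right 0)"
    using eventually_at_right_real[OF zero_less_one] by eventually_elim (simp add: trunc)
  ultimately have "((\<lambda>\<epsilon>. LINT y : - ball x \<epsilon> | lborel. (u x - u y) / dist x y powr p)
      \<longlongrightarrow> sym_frac s u x) (at_right 0)"
    by (rule Lim_transform_eventually)
  then have "Lim (at_right 0) (\<lambda>\<epsilon>. LINT y : - ball x \<epsilon> | lborel. (u x - u y) / dist x y powr p)
      = sym_frac s u x"
    by (intro tendsto_Lim) auto
  then show ?thesis
    by (simp add: frac_lap_def p_def)
qed

section \<open>From almost every point to every point\<close>

text \<open>The drift need not be continuous, so it is replaced by its essential bound. The relaxed
  expression is continuous on \<open>\<Omega>\<close>; the set where it is negative is open and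
  negligible, hence empty.\<close>

lemma supersolution_everywhere:
  fixes u :: "'a::euclidean_space \<Rightarrow> real"
  assumes s: "0 < s" "s < 1" and u: "continuous_on UNIV u"
    and \<Omega>: "open \<Omega>" "C2_on \<Omega> u" "bounded (range u)"
    and q_bdd: "\<exists>C. AE x in lebesgue_on \<Omega>. norm (q x) \<le> C"
    and ineq: "AE x in lebesgue_on \<Omega>.
      - laplacian u x + frac_lap s u x + frechet_derivative u (at x) (q x) \<ge> 0"
  obtains C where "0 \<le> C" "\<And>x. x \<in> \<Omega> \<Longrightarrow>
    0 \<le> - laplacian u x + frac_const DIM('a) s * sym_frac s u x + C * (\<Sum>b\<in>Basis. \<bar>d1 u b x\<bar>)"
proof -
  obtain C where C: "AE x in lebesgue_on \<Omega>. norm (q x) \<le> C"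
    using q_bdd by blast
  \<comment> \<open>\<open>max 0 C\<close> makes the coefficient nonnegative whatever the sign of
    \<open>C\<close>.\<close>
  define T where "T x = - laplacian u x + frac_const DIM('a) s * sym_frac s u x
      + max 0 C * (\<Sum>b\<in>Basis. \<bar>d1 u b x\<bar>)" for x
  have "continuous_on \<Omega> (d1 u b)" if "b \<in> Basis" for b
    using \<Omega>(2) that unfolding C2_on_def
    by (intro continuous_at_imp_continuous_on) (auto intro: differentiable_imp_continuous_within)
  then have "continuous_on \<Omega> T"
    unfolding T_def laplacian_def using \<Omega>(2)
    by (intro continuous_intros continuous_on_sym_frac[OF s u \<Omega>]) (auto simp: C2_on_def)
  then have "open (\<Omega> \<inter> T -` {..<0})"
    using \<Omega>(1) by (rule continuous_open_preimage) simp
  moreover have "negligible (\<Omega> \<inter> T -` {..<0})"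
  proof -
    have "AE x in lebesgue_on \<Omega>. x \<in> \<Omega> \<longrightarrow> 0 \<le> T x"
      using C ineq
    proof eventually_elim
      case (elim x)
      show ?case
      proof
        assume x: "x \<in> \<Omega>"
        have "u differentiable (at x)"
          using \<Omega>(2) x unfolding C2_on_def by blast
        then have "frechet_derivative u (at x) (q x) = (\<Sum>b\<in>Basis. (q x \<bullet> b) * d1 u b x)"
          by (rule frechet_derivative_eq_sum_d1)
        also have "\<dots> \<le> (\<Sum>b\<in>Basis. max 0 C * \<bar>d1 u b x\<bar>)"
        proof (rule sum_mono)
          fix b :: 'a assume "b \<in> Basis"
          then have "\<bar>q x \<bullet> b\<bar> \<le> max 0 C"
            using Basis_le_norm[of b "q x"] elim(1) by linarith
          then have "\<bar>q x \<bullet> b\<bar> * \<bar>d1 u b x\<bar> \<le> max 0 C * \<bar>d1 u b x\<bar>"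
            by (rule mult_right_mono) simp
          then show "(q x \<bullet> b) * d1 u b x \<le> max 0 C * \<bar>d1 u b x\<bar>"
            using abs_ge_self[of "(q x \<bullet> b) * d1 u b x"] unfolding abs_mult by linarith
        qed
        finally show "0 \<le> T x"
          using elim(2) frac_lap_eq_sym_frac[OF s u \<Omega> x] by (simp add: T_def sum_distrib_left)
      qed
    qed
    then have "AE x in lebesgue. x \<in> \<Omega> \<longrightarrow> 0 \<le> T x"
      using \<Omega>(1) by (subst (asm) AE_restrict_space_iff) auto
    then obtain N where "N \<in> null_sets lebesgue" "{x. \<not> (x \<in> \<Omega> \<longrightarrow> 0 \<le> T x)} \<subseteq> N"
      by (auto simp: eventually_ae_filter)
    then have "negligible {x. \<not> (x \<in> \<Omega> \<longrightarrow> 0 \<le> T x)}"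
      by (meson negligible_iff_null_sets negligible_subset)
    moreover have "\<Omega> \<inter> T -` {..<0} = {x. \<not> (x \<in> \<Omega> \<longrightarrow> 0 \<le> T x)}"
      by auto
    ultimately show ?thesis by simp
  qed
  ultimately have "\<Omega> \<inter> T -` {..<0} = {}"
    using open_not_negligible by blast
  then have "0 \<le> T x" if "x \<in> \<Omega>" for x
    using that by (meson IntI disjoint_iff lessThan_iff not_less vimageI2)
  then show thesis
    unfolding T_def by (intro that[of "max 0 C"]) auto
qed

section \<open>Touching from below and the strong minimum principle\<close>

text \<open>If \<open>m\<close> were negative, \<open>f'\<close> would vanish at 0 and be negative
  just to the right of it, and the mean value theorem would give a value below
  \<open>f 0\<close>.\<close>

lemma second_derivative_nonneg_at_min:
  fixes f f' :: "real \<Rightarrow> real"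
  assumes "0 < \<delta>"
    and f: "\<And>t. \<bar>t\<bar> < \<delta> \<Longrightarrow> (f has_real_derivative f' t) (at t)"
    and f': "(f' has_real_derivative m) (at 0)"
    and min: "\<And>t. \<bar>t\<bar> < \<delta> \<Longrightarrow> f 0 \<le> f t"
  shows "f' 0 = 0" "0 \<le> m"
proof -
  show 0: "f' 0 = 0"
    using DERIV_local_min[OF f[of 0] \<open>0 < \<delta>\<close>] \<open>0 < \<delta>\<close> min by auto
  show "0 \<le> m"
  proof (rule ccontr)
    assume "\<not> 0 \<le> m"
    then obtain d where d: "0 < d" "\<And>h. 0 < h \<Longrightarrow> h < d \<Longrightarrow> f' h < 0"
      using has_real_derivative_neg_dec_right[OF f'] 0 by force
    define t where "t = min d \<delta> / 2"
    have t: "0 < t" "t < d" "t < \<delta>"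
      using d \<open>0 < \<delta>\<close> by (auto simp: t_def min_def)
    obtain z where z: "0 < z" "z < t" "f t - f 0 = (t - 0) * f' z"
      using MVT2[of 0 t f f'] t f by force
    have "f' z < 0"
      using d z t by auto
    then have "t * f' z < 0"
      using t by (simp add: mult_pos_neg)
    then show False
      using z min[of t] t by simp
  qed
qed

text \<open>Along the coordinate line through \<open>x\<close> this is the one-variable minimum test
  for \<open>u\<close> minus \<open>\<psi>\<close> at \<open>t = 0\<close>. The test function lives
  on that line only: it is zero in the strong minimum principle and a Gaussian in the barrier
  argument.\<close>

lemma touching_below_conditions:
  fixes u :: "'a::euclidean_space \<Rightarrow> real"
  assumes \<Omega>: "open \<Omega>" "C2_on \<Omega> u" and x: "x \<in> \<Omega>" and b: "b \<in> Basis"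
    and \<psi>: "\<And>t. (\<psi> has_real_derivative \<psi>' t) (at t)" "(\<psi>' has_real_derivative m) (at 0)"
    and min: "\<And>t. u x - \<psi> 0 \<le> u (x + t *\<^sub>R b) - \<psi> t"
  shows "d1 u b x = \<psi>' 0" "m \<le> d2 u b b x"
proof -
  obtain \<delta> where \<delta>: "0 < \<delta>" "ball x \<delta> \<subseteq> \<Omega>"
    using \<Omega> x open_contains_ball by blast
  have line: "((\<lambda>t. x + t *\<^sub>R b) has_derivative (\<lambda>t. t *\<^sub>R b)) (at t)" for t
    by (auto intro!: derivative_eq_intros)
  have in\<Omega>: "x + t *\<^sub>R b \<in> \<Omega>" if "\<bar>t\<bar> < \<delta>" for t
    using \<delta>(2) that b by (auto simp: subset_iff dist_norm)
  have D: "((\<lambda>t. g (x + t *\<^sub>R b)) has_real_derivative d1 g b (x + t *\<^sub>R b)) (at t)"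
    if g: "g differentiable (at (x + t *\<^sub>R b))" for g :: "'a \<Rightarrow> real" and t
  proof -
    have "(g has_derivative frechet_derivative g (at (x + t *\<^sub>R b))) (at (x + t *\<^sub>R b))"
      using g frechet_derivative_works by blast
    from has_derivative_compose[OF line this]
    have "((\<lambda>t. g (x + t *\<^sub>R b)) has_derivative (\<lambda>r. frechet_derivative g (at (x + t *\<^sub>R b)) (r *\<^sub>R b))) (at t)" .
    moreover have "frechet_derivative g (at (x + t *\<^sub>R b)) (r *\<^sub>R b) = r * d1 g b (x + t *\<^sub>R b)" for r
      using linear_scale[OF linear_frechet_derivative[OF g]] by (simp add: d1_def)
    ultimately show ?thesis
      by (simp add: has_field_derivative_def mult_commute_abs)
  qed
  define f where "f t = u (x + t *\<^sub>R b) - \<psi> t" for t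
  define f' where "f' t = d1 u b (x + t *\<^sub>R b) - \<psi>' t" for t
  have f: "(f has_real_derivative f' t) (at t)" if "\<bar>t\<bar> < \<delta>" for t
    unfolding f_def f'_def using \<Omega>(2) in\<Omega>[OF that] unfolding C2_on_def
    by (intro DERIV_diff D \<psi>) auto
  have "((\<lambda>t. d1 u b (x + t *\<^sub>R b)) has_real_derivative d1 (d1 u b) b (x + 0 *\<^sub>R b)) (at 0)"
    by (rule D) (use \<Omega>(2) x b in \<open>auto simp: C2_on_def\<close>)
  then have f': "(f' has_real_derivative (d2 u b b x - m)) (at 0)"
    unfolding f'_def d2_def by (intro DERIV_diff \<psi>) (simp add: d1_def[of "d1 u b"])
  have mn: "f 0 \<le> f t" for t
    using min[of t] by (simp add: f_def)
  show "d1 u b x = \<psi>' 0" "m \<le> d2 u b b x"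
    using second_derivative_nonneg_at_min[OF \<delta>(1) f f' mn] by (auto simp: f'_def)
qed

lemma frac_const_pos:
  assumes "0 < s" "s < 1"
  shows "0 < frac_const N s"
  using assms unfolding frac_const_def
  by (intro divide_pos_pos mult_pos_pos Gamma_real_pos add_nonneg_pos) auto

text \<open>At a global minimum the integrand has a sign. If the integral vanished, the integrand
  would vanish almost everywhere, yet it is nonzero on the open set of \<open>h\<close> with
  \<open>u x < u (x + h)\<close>, which contains \<open>y - x\<close>. The point \<open>y\<close>
  may lie anywhere in the space.\<close>

lemma sym_frac_neg_at_min:
  fixes u :: "'a::euclidean_space \<Rightarrow> real"
  assumes s: "0 < s" "s < 1" and u: "continuous_on UNIV u"
    and \<Omega>: "open \<Omega>" "C2_on \<Omega> u" "bounded (range u)" and x: "x \<in> \<Omega>"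
    and min: "\<And>y. u x \<le> u y" and y: "u x < u y"
  shows "sym_frac s u x < 0"
proof -
  define p where "p = real DIM('a) + 2 * s"
  define K where "K h = (u (x + h) + u (x - h) - 2 * u x) / norm h powr p" for h
  have Keq: "K = (\<lambda>h. - ((2 * u x - u (x + h) - u (x - h)) / norm h powr p))"
    by (auto simp: K_def minus_divide_left)
  have K: "integrable lborel K"
    unfolding Keq p_def by (intro integrable_minus integrable_sym_kernel[OF s u \<Omega> x])
  have nn: "0 \<le> K h" for h
    using min[of "x + h"] min[of "x - h"] by (simp add: K_def)
  have "(LINT h|lborel. K h) \<noteq> 0"
  proof
    assume "(LINT h|lborel. K h) = 0"
    then have "AE h in lborel. K h = 0"
      using integral_nonneg_eq_0_iff_AE[OF K] nn by simp
    then have "AE h in lebesgue. K h = 0"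
      by (rule AE_completion)
    then obtain N where N: "N \<in> null_sets lebesgue" "{h. K h \<noteq> 0} \<subseteq> N"
      by (auto simp: eventually_ae_filter)
    define U where "U = {h. u x < u (x + h)}"
    have "open U"
      unfolding U_def
      by (intro open_Collect_less continuous_intros continuous_on_compose2[OF u]) auto
    moreover have "y - x \<in> U"
      using y by (simp add: U_def)
    moreover have "U \<subseteq> {h. K h \<noteq> 0}"
    proof
      fix h assume "h \<in> U"
      then have "u x < u (x + h)" "h \<noteq> 0"
        by (auto simp: U_def)
      then have "0 < K h"
        using min[of "x - h"] by (simp add: K_def)
      then show "h \<in> {h. K h \<noteq> 0}" by simp
    qed
    then have "negligible U"
      using N by (meson negligible_iff_null_sets negligible_subset)
    ultimately show False
      using open_not_negligible by blast
  qed
  moreover have "0 \<le> (LINT h|lborel. K h)"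
    by (intro integral_nonneg_AE AE_I2 nn)
  moreover have "sym_frac s u x = - (LINT h|lborel. K h) / 2"
    unfolding Keq sym_frac_def p_def by simp
  ultimately show ?thesis by linarith
qed

text \<open>At a point of \<open>\<Omega>\<close> with value \<open>c0\<close> the gradient
  vanishes, the Laplacian is nonnegative and the nonlocal term is strictly negative, because it sees
  a larger value wherever that occurs. The inequality fails at this very point, so nothing has to be
  propagated through \<open>\<Omega>\<close>.\<close>

lemma strong_minimum_principle:
  fixes u :: "'a::euclidean_space \<Rightarrow> real"
  assumes s: "0 < s" "s < 1" and u: "continuous_on UNIV u"
    and \<Omega>: "open \<Omega>" "C2_on \<Omega> u" "bounded (range u)"
    and super: "\<And>x. x \<in> \<Omega> \<Longrightarrow>
      0 \<le> - laplacian u x + frac_const DIM('a) s * sym_frac s u x + C * (\<Sum>b\<in>Basis. \<bar>d1 u b x\<bar>)"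
    and ge: "\<And>x. c0 \<le> u x" and nonconst: "\<exists>x. u x \<noteq> c0" and x: "x \<in> \<Omega>"
  shows "c0 < u x"
proof (rule ccontr)
  assume "\<not> c0 < u x"
  then have ux: "u x = c0"
    using ge[of x] by linarith
  have touch: "d1 u b x = 0" "0 \<le> d2 u b b x" if "b \<in> Basis" for b
    using touching_below_conditions[OF \<Omega>(1,2) x that, of "\<lambda>_. 0" "\<lambda>_. 0" 0] ge ux by auto
  obtain y where "u x < u y"
    using nonconst ge ux by (metis order_le_imp_less_or_eq)
  then have "frac_const DIM('a) s * sym_frac s u x < 0"
    using sym_frac_neg_at_min[OF s u \<Omega> x _ \<open>u x < u y\<close>] ge ux frac_const_pos[OF s]
    by (intro mult_pos_neg) auto
  moreover have "0 \<le> laplacian u x"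
    unfolding laplacian_def by (intro sum_nonneg touch)
  moreover have "(\<Sum>b\<in>Basis. \<bar>d1 u b x\<bar>) = 0"
    by (simp add: touch)
  ultimately show False
    using super[OF x] by simp
qed

section \<open>The exponential barrier in a ball\<close>

text \<open>If the bound failed, \<open>u - \<epsilon> * G\<close> would attain its minimum over the
  closed ball at a point \<open>x1\<close> away from both the centre and the boundary. There the
  differential inequality weighs a Laplacian of order \<alpha>^2 against remaining terms of order
  \<alpha>, all carrying the value of the Gaussian at \<open>x1\<close> as a factor.\<close>

lemma hopf_barrier:
  fixes u :: "'a::euclidean_space \<Rightarrow> real"
  assumes s: "0 < s" "s < 1" and u: "continuous_on UNIV u"
    and \<Omega>: "open \<Omega>" "C2_on \<Omega> u" "bounded (range u)"
    and C: "0 \<le> C" and super: "\<And>x. x \<in> \<Omega> \<Longrightarrow>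
      0 \<le> - laplacian u x + frac_const DIM('a) s * sym_frac s u x + C * (\<Sum>b\<in>Basis. \<bar>d1 u b x\<bar>)"
    and ge: "\<And>x. c0 \<le> u x" and pos: "\<And>x. x \<in> \<Omega> \<Longrightarrow> c0 < u x"
    and r: "0 < r" "ball y r \<subseteq> \<Omega>"
  obtains \<epsilon> \<alpha> where "0 < \<epsilon>" "0 < \<alpha>" "\<And>x. x \<in> ball y r \<Longrightarrow>
    c0 + \<epsilon> * (exp (- \<alpha> * (norm (x - y))\<^sup>2) - exp (- \<alpha> * r\<^sup>2)) \<le> u x"
proof -
  define p where "p = real DIM('a) + 2 * s"
  define J where "J = (LINT h|lborel. min 1 ((norm (h::'a))\<^sup>2) / norm h powr p)"
  have J: "0 \<le> J"
    unfolding J_def by (intro integral_nonneg_AE AE_I2) auto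
  define c where "c = frac_const DIM('a) s"
  have c: "0 < c"
    unfolding c_def using frac_const_pos[OF s] .
  define n where "n = real DIM('a)"
  have n: "0 < n"
    by (simp add: n_def)
  \<comment> \<open>\<open>Q\<close> collects the contributions of order \<alpha>:
    \<open>2 * n\<close> from the Laplacian of the Gaussian, \<open>c * J\<close> from the nonlocal
    term and \<open>2 * C * n * r\<close> from the gradient. Then \<open>\<alpha>\<close> is chosen
    so that \<open>\<alpha> * r\<^sup>2\<close> exceeds \<open>Q\<close>;
    \<open>\<alpha> \<ge> 1\<close> serves the nonlocal estimate.\<close>
  define Q where "Q = 2 * n + c * J + 2 * C * n * r"
  have Q: "0 \<le> Q"
    using n c J C r by (simp add: Q_def)
  define \<alpha> where "\<alpha> = 1 + Q / r\<^sup>2"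
  have \<alpha>: "1 \<le> \<alpha>" "Q < \<alpha> * r\<^sup>2"
    using r Q by (auto simp: \<alpha>_def distrib_right)
  define g where "g x = exp (- \<alpha> * (norm (x - y))\<^sup>2)" for x
  define G where "G x = g x - exp (- \<alpha> * r\<^sup>2)" for x
  have cont_u: "continuous_on A u" for A
    using u continuous_on_subset by blast
  have "\<exists>x0\<in>cball y (r/2). \<forall>x\<in>cball y (r/2). u x0 \<le> u x"
    using r by (intro continuous_attains_inf cont_u) auto
  then obtain w where w: "w \<in> cball y (r/2)" "\<And>x. x \<in> cball y (r/2) \<Longrightarrow> u w \<le> u x"
    by blast
  \<comment> \<open>This is the least value of \<open>u - c0\<close> on the closed half ball. Since
    \<open>G \<le> 1\<close>, the touching point cannot lie there, which keeps it away from the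
    centre, where the Laplacian of the Gaussian is negative.\<close>
  define \<epsilon> where "\<epsilon> = u w - c0"
  have "w \<in> ball y r"
    using w(1) r by simp
  then have \<epsilon>: "0 < \<epsilon>"
    using pos r(2) by (auto simp: \<epsilon>_def)
  have "c0 + \<epsilon> * G x \<le> u x" if x: "x \<in> ball y r" for x
  proof (rule ccontr)
    assume neg: "\<not> c0 + \<epsilon> * G x \<le> u x"
    have "continuous_on (cball y r) (\<lambda>x. u x - \<epsilon> * G x)"
      unfolding G_def g_def by (intro continuous_intros cont_u)
    then have "\<exists>x1\<in>cball y r. \<forall>x\<in>cball y r. u x1 - \<epsilon> * G x1 \<le> u x - \<epsilon> * G x"
      using r by (intro continuous_attains_inf) auto
    then obtain x1 where x1: "x1 \<in> cball y r" "\<And>x. x \<in> cball y r \<Longrightarrow> u x1 - \<epsilon> * G x1 \<le> u x - \<epsilon> * G x"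
      by blast
    have neg1: "u x1 - c0 < \<epsilon> * G x1"
      using neg x1(2)[of x] x by simp
    define z where "z = x1 - y"
    define \<rho> where "\<rho> = norm z"
    define E where "E = \<epsilon> * exp (- \<alpha> * \<rho>\<^sup>2)"
    have E: "0 < E"
      using \<epsilon> by (simp add: E_def)
    have Eg: "\<epsilon> * g x1 = E"
      by (simp add: E_def g_def z_def \<rho>_def)
    have G_nonpos: "G x \<le> 0" if "x \<notin> ball y r" for x
    proof -
      have "r\<^sup>2 \<le> (norm (x - y))\<^sup>2"
        using that r by (intro power_mono) (auto simp: dist_norm norm_minus_commute)
      then show ?thesis
        using \<alpha> by (simp add: G_def g_def)
    qed
    \<comment> \<open>Outside the open ball \<open>G \<le> 0\<close> while
      \<open>u \<ge> c0\<close>, which contradicts \<open>neg1\<close>.\<close>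
    have "x1 \<in> ball y r"
      using neg1 G_nonpos[of x1] ge[of x1] \<epsilon> mult_nonneg_nonpos[of \<epsilon> "G x1"] by fastforce
    then have x1\<Omega>: "x1 \<in> \<Omega>" and "\<rho> < r"
      using r(2) by (auto simp: \<rho>_def z_def dist_norm norm_minus_commute)
    have "x1 \<notin> cball y (r/2)"
    proof
      assume "x1 \<in> cball y (r/2)"
      then have "\<epsilon> \<le> u x1 - c0"
        using w(2) by (simp add: \<epsilon>_def)
      moreover have "G x1 \<le> 1"
      proof -
        have "g x1 \<le> 1"
          using \<alpha> by (simp add: g_def)
        then show ?thesis
          unfolding G_def using exp_ge_zero[of "- \<alpha> * r\<^sup>2"] by linarith
      qed
      then have "\<epsilon> * G x1 \<le> \<epsilon> * 1"
        using \<epsilon> by (intro mult_left_mono) auto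
      ultimately show False
        using neg1 by simp
    qed
    then have \<rho>: "r / 2 \<le> \<rho>"
      by (simp add: \<rho>_def z_def dist_norm norm_minus_commute)
    \<comment> \<open>The nonlocal term requires touching on the whole space, not only in the ball.
      Outside the ball it follows from \<open>G \<le> 0\<close> and \<open>u \<ge> c0\<close>; the
      constant by which \<open>G\<close> and \<open>g\<close> differ cancels.\<close>
    have glob: "u x1 - \<epsilon> * g x1 \<le> u x - \<epsilon> * g x" for x
    proof (cases "x \<in> cball y r")
      case True
      then show ?thesis
        using x1(2)[of x] by (simp add: G_def algebra_simps)
    next
      case False
      then have "\<epsilon> * G x \<le> 0"
        using G_nonpos[of x] \<epsilon> by (simp add: mult_nonneg_nonpos)
      then have "u x1 - \<epsilon> * G x1 \<le> u x - \<epsilon> * G x"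
        using neg1 ge[of x] by linarith
      then show ?thesis
        by (simp add: G_def algebra_simps)
    qed
    have gexp: "g (x1 + h) = exp (- \<alpha> * (\<rho>\<^sup>2 + 2 * (z \<bullet> h) + (norm h)\<^sup>2))" for h
      unfolding g_def \<rho>_def z_def
      by (simp add: power2_norm_eq_inner inner_simps inner_commute algebra_simps)
    \<comment> \<open>Convexity in the form \<open>1 + d \<le> exp d\<close>. The part linear in
      \<open>h\<close> cancels between \<open>h\<close> and \<open>- h\<close>, and the quadratic
      part is only of order \<alpha>; a bound through second derivatives of the Gaussian would bring
      in order \<alpha>^2 and compete with the Laplacian.\<close>
    have drop: "u x1 - u (x1 + h) \<le> E * (2 * \<alpha> * (z \<bullet> h) + \<alpha> * (norm h)\<^sup>2)" for h
    proof -
      define d where "d = - \<alpha> * (2 * (z \<bullet> h) + (norm h)\<^sup>2)"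
      have "g (x1 + h) = exp (- \<alpha> * \<rho>\<^sup>2) * exp d"
        unfolding gexp d_def by (simp add: algebra_simps flip: exp_add)
      then have "\<epsilon> * g (x1 + h) = E * exp d"
        by (simp add: E_def)
      moreover have "E * (1 + d) \<le> E * exp d"
        using E exp_ge_add_one_self[of d] by (intro mult_left_mono) auto
      ultimately have "E - \<epsilon> * g (x1 + h) \<le> E * (- d)"
        by (simp add: algebra_simps)
      also have "- d = 2 * \<alpha> * (z \<bullet> h) + \<alpha> * (norm h)\<^sup>2"
        by (simp add: d_def algebra_simps)
      finally show ?thesis
        using glob[of "x1 + h"] Eg by linarith
    qed
    have frac: "sym_frac s u x1 \<le> E * \<alpha> * J"
    proof -
      \<comment> \<open>For large \<open>h\<close> the second difference is at most
        \<open>2 * (u x1 - c0)\<close>, which \<open>neg1\<close> bounds by \<open>2 * E\<close>.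
        Both branches of the minimum thus carry the factor \<open>E\<close>, however large
        \<open>u\<close> is elsewhere.\<close>
      have bound: "2 * u x1 - u (x1 + h) - u (x1 - h) \<le> 2 * E * \<alpha> * min 1 ((norm h)\<^sup>2)" for h
      proof -
        have "2 * u x1 - u (x1 + h) - u (x1 - h) \<le> 2 * (u x1 - c0)"
          using add_mono[OF ge[of "x1 + h"] ge[of "x1 - h"]] by (simp add: right_diff_distrib)
        also have "u x1 - c0 \<le> E"
        proof -
          have "\<epsilon> * G x1 \<le> \<epsilon> * g x1"
            using \<epsilon> by (intro mult_left_mono) (auto simp: G_def)
          then show ?thesis using neg1 Eg by linarith
        qed
        also have "2 * E \<le> 2 * E * \<alpha>"
          using E \<alpha>(1) by simp
        finally have 1: "2 * u x1 - u (x1 + h) - u (x1 - h) \<le> 2 * E * \<alpha>"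
          by simp
        have 2: "2 * u x1 - u (x1 + h) - u (x1 - h) \<le> 2 * E * \<alpha> * (norm h)\<^sup>2"
          using drop[of h] drop[of "- h"] by (simp add: algebra_simps)
        from 1 2 show ?thesis
          by (simp add: min_def)
      qed
      have "(LINT h|lborel. (2 * u x1 - u (x1 + h) - u (x1 - h)) / norm h powr p)
          \<le> (LINT h|lborel. 2 * E * \<alpha> * (min 1 ((norm (h::'a))\<^sup>2) / norm h powr p))"
        unfolding p_def
        by (intro integral_mono integrable_sym_kernel[OF s u \<Omega> x1\<Omega>] integrable_mult_right
            integrable_truncated_kernel[OF s] sym_kernel_le bound)
      also have "\<dots> = 2 * E * \<alpha> * J"
        unfolding J_def by (rule integral_mult_right_zero)
      finally show ?thesis
        by (simp add: sym_frac_def p_def)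
    qed
    have d12: "d1 u b x1 = - 2 * \<alpha> * (z \<bullet> b) * E" "E * (4 * \<alpha>\<^sup>2 * (z \<bullet> b)\<^sup>2 - 2 * \<alpha>) \<le> d2 u b b x1"
      if b: "b \<in> Basis" for b
    proof -
      \<comment> \<open>The restriction of \<open>\<epsilon> * g\<close> to the line
        \<open>x1 + t *\<^sub>R b\<close>, where \<open>b\<close> has norm 1.\<close>
      define \<psi> where "\<psi> t = \<epsilon> * exp (- \<alpha> * (\<rho>\<^sup>2 + 2 * t * (z \<bullet> b) + t\<^sup>2))" for t
      define \<psi>' where "\<psi>' t = - 2 * \<alpha> * (z \<bullet> b + t) * \<psi> t" for t
      have \<psi>: "(\<psi> has_real_derivative \<psi>' t) (at t)" for t
      proof -
        have "((\<lambda>t. - \<alpha> * (\<rho>\<^sup>2 + 2 * t * (z \<bullet> b) + t\<^sup>2)) has_real_derivative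
            - 2 * \<alpha> * (z \<bullet> b + t)) (at t)"
          by (auto intro!: derivative_eq_intros simp: algebra_simps)
        from DERIV_cmult[OF DERIV_fun_exp[OF this], of \<epsilon>]
        show ?thesis
          unfolding \<psi>'_def \<psi>_def by (simp only: ac_simps)
      qed
      have \<psi>0: "\<psi> 0 = E" by (simp add: \<psi>_def E_def)
      have "(\<psi>' has_real_derivative (- 2 * \<alpha> * \<psi> 0 + - 2 * \<alpha> * (z \<bullet> b + 0) * \<psi>' 0)) (at 0)"
        unfolding \<psi>'_def[abs_def]
        by (auto intro!: derivative_eq_intros \<psi> simp: \<psi>'_def)
      also have "- 2 * \<alpha> * \<psi> 0 + - 2 * \<alpha> * (z \<bullet> b + 0) * \<psi>' 0 = E * (4 * \<alpha>\<^sup>2 * (z \<bullet> b)\<^sup>2 - 2 * \<alpha>)"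
        by (simp add: \<psi>'_def \<psi>0 power2_eq_square algebra_simps)
      finally have \<psi>'': "(\<psi>' has_real_derivative (E * (4 * \<alpha>\<^sup>2 * (z \<bullet> b)\<^sup>2 - 2 * \<alpha>))) (at 0)" .
      have "\<epsilon> * g (x1 + t *\<^sub>R b) = \<psi> t" for t
        unfolding gexp \<psi>_def using b by (simp add: algebra_simps)
      then have "u x1 - \<psi> 0 \<le> u (x1 + t *\<^sub>R b) - \<psi> t" for t
        using glob[of "x1 + t *\<^sub>R b"] Eg \<psi>0 by simp
      note touching_below_conditions[OF \<Omega>(1,2) x1\<Omega> b \<psi> \<psi>'' this]
      then show "d1 u b x1 = - 2 * \<alpha> * (z \<bullet> b) * E" "E * (4 * \<alpha>\<^sup>2 * (z \<bullet> b)\<^sup>2 - 2 * \<alpha>) \<le> d2 u b b x1"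
        by (simp_all add: \<psi>'_def \<psi>0)
    qed
    have "(\<Sum>b\<in>Basis. E * (4 * \<alpha>\<^sup>2 * (z \<bullet> b)\<^sup>2 - 2 * \<alpha>)) \<le> laplacian u x1"
      unfolding laplacian_def by (intro sum_mono d12)
    also have "(\<Sum>b\<in>Basis. E * (4 * \<alpha>\<^sup>2 * (z \<bullet> b)\<^sup>2 - 2 * \<alpha>)) = E * (4 * \<alpha>\<^sup>2 * (\<Sum>b\<in>Basis. (z \<bullet> b)\<^sup>2) - 2 * \<alpha> * n)"
      by (simp add: n_def sum_subtractf algebra_simps sum_distrib_left)
    also have "(\<Sum>b\<in>Basis. (z \<bullet> b)\<^sup>2) = \<rho>\<^sup>2"
      by (simp add: \<rho>_def norm_eq_sqrt_inner euclidean_inner[of z z] power2_eq_square sum_nonneg)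
    finally have lap: "E * (4 * \<alpha>\<^sup>2 * \<rho>\<^sup>2 - 2 * \<alpha> * n) \<le> laplacian u x1" .
    have "(\<Sum>b\<in>Basis. \<bar>d1 u b x1\<bar>) \<le> (\<Sum>b\<in>(Basis::'a set). E * \<alpha> * (2 * r))"
    proof (rule sum_mono)
      fix b :: 'a assume b: "b \<in> Basis"
      have "\<bar>z \<bullet> b\<bar> \<le> r"
        using Basis_le_norm[OF b, of z] \<open>\<rho> < r\<close> by (simp add: \<rho>_def)
      then have "E * \<alpha> * 2 * \<bar>z \<bullet> b\<bar> \<le> E * \<alpha> * 2 * r"
        using E \<alpha> by (intro mult_left_mono) auto
      then show "\<bar>d1 u b x1\<bar> \<le> E * \<alpha> * (2 * r)"
        using E \<alpha> by (simp add: d12(1)[OF b] abs_mult algebra_simps)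
    qed
    then have "C * (\<Sum>b\<in>Basis. \<bar>d1 u b x1\<bar>) \<le> C * (n * (E * \<alpha> * (2 * r)))"
      using C by (intro mult_left_mono) (auto simp: n_def)
    moreover have "c * sym_frac s u x1 \<le> c * (E * \<alpha> * J)"
      using frac c by (intro mult_left_mono) auto
    \<comment> \<open>After the common factor \<open>E * \<alpha>\<close> is taken out, the sign is
      decided by \<open>4 * \<alpha> * \<rho>\<^sup>2 \<ge> \<alpha> * r\<^sup>2 > Q\<close>, which
      holds because \<open>\<rho> \<ge> r / 2\<close>.\<close>
    ultimately have "0 \<le> - (E * (4 * \<alpha>\<^sup>2 * \<rho>\<^sup>2 - 2 * \<alpha> * n)) + c * (E * \<alpha> * J) + C * (n * (E * \<alpha> * (2 * r)))"
      using super[OF x1\<Omega>] lap unfolding c_def by linarith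
    also have "\<dots> = E * \<alpha> * (Q - 4 * \<alpha> * \<rho>\<^sup>2)"
      by (simp add: Q_def power2_eq_square algebra_simps)
    finally have "0 \<le> E * \<alpha> * (Q - 4 * \<alpha> * \<rho>\<^sup>2)" .
    moreover have "(r / 2)\<^sup>2 \<le> \<rho>\<^sup>2"
      using \<rho> r by (intro power_mono) auto
    then have "\<alpha> * r\<^sup>2 \<le> 4 * \<alpha> * \<rho>\<^sup>2"
      using \<alpha> by (simp add: power_divide)
    then have "Q - 4 * \<alpha> * \<rho>\<^sup>2 < 0"
      using \<alpha>(2) by linarith
    then have "E * \<alpha> * (Q - 4 * \<alpha> * \<rho>\<^sup>2) < 0"
      using E \<alpha>(1) by (intro mult_pos_neg) auto
    ultimately show False by linarith
  qed
  then show thesis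
    using that[of \<epsilon> \<alpha>] \<epsilon> \<alpha>(1) by (auto simp: G_def g_def)
qed

section \<open>An interior ball touching the boundary point\<close>

lemma norm_hproj_le:
  assumes "norm e = 1"
  shows "norm (hproj e v) \<le> norm v"
proof (rule power2_le_imp_le)
  have "e \<bullet> e = 1"
    using assms by (simp add: norm_eq_1)
  then have "(norm (hproj e v))\<^sup>2 = (norm v)\<^sup>2 - (v \<bullet> e)\<^sup>2"
    unfolding hproj_def power2_norm_eq_inner
    by (simp add: inner_simps inner_commute power2_eq_square algebra_simps)
  then show "(norm (hproj e v))\<^sup>2 \<le> (norm v)\<^sup>2"
    by simp
qed simp

text \<open>With \<open>v = x - x0\<close>, Taylor's bound gives \<open>\<psi> x \<le> \<gamma> *
  (\<nu> \<bullet> v) + M * (norm v)\<^sup>2\<close>, and lying in the ball tangent at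
  \<open>x0\<close> means \<open>(norm v)\<^sup>2 < - 2 * r * (\<nu> \<bullet> v)\<close>. For a
  small radius the linear term wins and \<open>\<psi> x\<close> is negative.\<close>

lemma interior_ball:
  fixes \<Omega> :: "'a::euclidean_space set"
  assumes \<Omega>: "open \<Omega>" and x0: "x0 \<in> frontier \<Omega>" and \<nu>: "outer_unit_normal \<Omega> x0 \<nu>"
  obtains r where "0 < r" "norm \<nu> = 1" "ball (x0 - r *\<^sub>R \<nu>) r \<subseteq> \<Omega>"
proof -
  obtain R e \<phi> where chart: "C2_chart \<Omega> x0 R e \<phi>"
    and \<nu>_eq: "\<nu> = (1 / norm (grad (\<lambda>x. x \<bullet> e - \<phi> (hproj e x)) x0)) *\<^sub>R grad (\<lambda>x. x \<bullet> e - \<phi> (hproj e x)) x0"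
    using \<nu> by (auto simp: outer_unit_normal_def Let_def)
  define \<psi> where "\<psi> x = x \<bullet> e - \<phi> (hproj e x)" for x
  define \<gamma> where "\<gamma> = norm (grad \<psi> x0)"
  have R: "0 < R" and e: "norm e = 1" and C2: "C2_on UNIV \<phi>"
    and loc: "\<Omega> \<inter> ball x0 R = {x \<in> ball x0 R. \<psi> x < 0}"
    using chart by (auto simp: C2_chart_def \<psi>_def)
  define p0 where "p0 = hproj e x0"
  have hproj_der: "(hproj e has_derivative hproj e) (at x)" for x
    unfolding hproj_def[abs_def] by (auto intro!: derivative_eq_intros)
  have hproj_diff: "hproj e x - p0 = hproj e (x - x0)" for x
    by (simp add: hproj_def p0_def inner_simps algebra_simps)
  have \<phi>_der: "(\<phi> has_derivative frechet_derivative \<phi> (at p)) (at p)" for p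
    using C2 frechet_derivative_works unfolding C2_on_def by blast
  have \<psi>_der: "(\<psi> has_derivative (\<lambda>v. v \<bullet> e - frechet_derivative \<phi> (at (hproj e x)) (hproj e v))) (at x)" for x
    unfolding \<psi>_def
    by (intro has_derivative_diff has_derivative_compose[OF hproj_der \<phi>_der])
      (auto intro!: derivative_eq_intros)
  have \<psi>_cont: "continuous_on UNIV \<psi>"
    using \<psi>_der by (meson continuous_at_imp_continuous_on has_derivative_continuous)
  have grad: "grad \<psi> x0 \<bullet> v = v \<bullet> e - frechet_derivative \<phi> (at p0) (hproj e v)" for v
  proof -
    have "\<psi> differentiable (at x0)"
      using \<psi>_der differentiable_def by blast
    then have "frechet_derivative \<psi> (at x0) v = (\<Sum>b\<in>Basis. (v \<bullet> b) * d1 \<psi> b x0)"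
      by (rule frechet_derivative_eq_sum_d1)
    then have "grad \<psi> x0 \<bullet> v = frechet_derivative \<psi> (at x0) v"
      unfolding grad_def d1_def[symmetric] by (simp add: inner_sum_left mult.commute inner_commute[of v])
    then show ?thesis
      using fun_cong[OF frechet_derivative_at[OF \<psi>_der[of x0]], of v] by (simp add: p0_def)
  qed
  \<comment> \<open>\<open>\<phi>\<close> is evaluated at the projection along \<open>e\<close>, so
    \<open>\<psi>\<close> grows at unit rate in that direction. The gradient is therefore nonzero
    and its normalization a genuine unit vector.\<close>
  have "grad \<psi> x0 \<bullet> e = 1"
  proof -
    have "hproj e e = 0"
      using e by (simp add: hproj_def norm_eq_1)
    moreover have "frechet_derivative \<phi> (at p0) 0 = 0"
      using \<phi>_der has_derivative_bounded_linear linear_0 bounded_linear.linear by blast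
    ultimately show ?thesis
      using grad[of e] e by (simp add: norm_eq_1)
  qed
  then have \<gamma>: "0 < \<gamma>"
    by (auto simp: \<gamma>_def)
  have \<nu>': "grad \<psi> x0 = \<gamma> *\<^sub>R \<nu>" "norm \<nu> = 1"
    using \<gamma> \<nu>_eq unfolding \<psi>_def[symmetric] \<gamma>_def[symmetric] by (auto simp: \<gamma>_def)
  \<comment> \<open>Otherwise \<open>\<psi>\<close> would be positive on a neighbourhood of
    \<open>x0\<close>, which would then miss \<open>\<Omega>\<close>.\<close>
  have \<psi>0: "\<psi> x0 \<le> 0"
  proof (rule ccontr)
    assume "\<not> \<psi> x0 \<le> 0"
    then have "x0 \<in> ball x0 R \<inter> \<psi> -` {0<..}"
      using R by auto
    moreover have "open (ball x0 R \<inter> \<psi> -` {0<..})"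
      using \<psi>_cont by (intro continuous_open_preimage) (auto intro: continuous_on_subset)
    moreover have "(ball x0 R \<inter> \<psi> -` {0<..}) \<inter> \<Omega> = {}"
      using loc by force
    ultimately have "x0 \<notin> closure \<Omega>"
      by (meson disjoint_iff open_Int_closure_eq_empty)
    then show False
      using x0 by (simp add: frontier_def)
  qed
  obtain M where M: "0 \<le> M" "\<And>p q. p \<in> cball p0 1 \<Longrightarrow> q \<in> cball p0 1 \<Longrightarrow>
    \<bar>\<phi> q - \<phi> p - frechet_derivative \<phi> (at p) (q - p)\<bar> \<le> M * (norm (q - p))\<^sup>2"
    using C2_Taylor[OF C2, of p0 1] by auto
  \<comment> \<open>Points of the ball have distance below \<open>2 * r\<close> from
    \<open>x0\<close>: \<open>R / 2\<close> keeps them in the chart and \<open>1 / 2\<close> keeps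
    their projections where Taylor's bound holds. The last entry gives
    \<open>M + 1 \<le> \<gamma> / (2 * r)\<close>, which absorbs the quadratic error.\<close>
  define r where "r = min (min (R / 2) (1 / 2)) (\<gamma> / (2 * (M + 1)))"
  have r: "0 < r" "2 * r \<le> R" "2 * r \<le> 1" "r \<le> \<gamma> / (2 * (M + 1))"
    using R \<gamma> M by (auto simp: r_def)
  have rM: "M + 1 \<le> \<gamma> / (2 * r)"
    using r M by (simp add: field_simps)
  have "x \<in> \<Omega>" if x: "x \<in> ball (x0 - r *\<^sub>R \<nu>) r" for x
  proof -
    define v where "v = x - x0"
    define D where "D = norm v"
    have lt: "norm (v + r *\<^sub>R \<nu>) < r"
      using x by (simp add: v_def dist_norm norm_minus_commute algebra_simps)
    then have "(norm (v + r *\<^sub>R \<nu>))\<^sup>2 < r\<^sup>2"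
      using r by (intro power_strict_mono) auto
    then have vn: "D\<^sup>2 < - 2 * r * (\<nu> \<bullet> v)"
      using \<nu>'(2) unfolding D_def power2_norm_eq_inner norm_eq_1
      by (simp add: inner_simps inner_commute power2_eq_square)
    have "D \<le> norm (v + r *\<^sub>R \<nu>) + norm (r *\<^sub>R \<nu>)"
      using norm_triangle_ineq4[of "v + r *\<^sub>R \<nu>" "r *\<^sub>R \<nu>"] by (simp add: D_def)
    then have D: "D < 2 * r"
      using lt r \<nu>'(2) by simp
    have hv: "norm (hproj e v) \<le> D"
      using norm_hproj_le[OF e] by (simp add: D_def)
    have "hproj e x \<in> cball p0 1"
      using hv D r hproj_diff[of x] by (simp add: dist_norm norm_minus_commute[of p0] v_def)
    then have "\<bar>\<phi> (hproj e x) - \<phi> p0 - frechet_derivative \<phi> (at p0) (hproj e v)\<bar> \<le> M * (norm (hproj e v))\<^sup>2"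
      using M(2)[of p0 "hproj e x"] hproj_diff[of x] by (simp add: v_def)
    also have "\<dots> \<le> M * D\<^sup>2"
      using hv M by (intro mult_left_mono power_mono) auto
    finally have "\<phi> p0 + frechet_derivative \<phi> (at p0) (hproj e v) - M * D\<^sup>2 \<le> \<phi> (hproj e x)"
      by linarith
    then have "\<psi> x \<le> \<psi> x0 + grad \<psi> x0 \<bullet> v + M * D\<^sup>2"
      unfolding grad by (simp add: \<psi>_def p0_def v_def inner_simps)
    then have "\<psi> x \<le> \<gamma> * (\<nu> \<bullet> v) + M * D\<^sup>2"
      using \<psi>0 \<nu>'(1) by simp
    moreover have "\<gamma> * (\<nu> \<bullet> v) < - (\<gamma> / (2 * r)) * D\<^sup>2"
    proof -
      have "\<gamma> / (2 * r) * D\<^sup>2 < \<gamma> / (2 * r) * (- 2 * r * (\<nu> \<bullet> v))"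
        using vn \<gamma> r by (intro mult_strict_left_mono) auto
      then show ?thesis
        using r by simp
    qed
    moreover have "(M + 1) * D\<^sup>2 \<le> \<gamma> / (2 * r) * D\<^sup>2"
      using rM by (intro mult_right_mono) auto
    ultimately have "\<psi> x < - D\<^sup>2"
      by (simp add: algebra_simps)
    then have "\<psi> x < 0"
      using zero_le_power2[of D] by linarith
    moreover have "x \<in> ball x0 R"
      using D r by (simp add: D_def v_def dist_norm norm_minus_commute)
    ultimately show ?thesis
      using loc by blast
  qed
  then show thesis
    using that[of r] r(1) \<nu>'(2) by blast
qed

section \<open>The normal derivative and the conclusion\<close>

text \<open>\<open>normal_deriv\<close> is defined through \<open>Lim\<close>, which carries
  information only if the limit exists. It exists because the partial derivatives extend
  continuously to the closure, and it is unique because \<open>x0\<close> is a limit point of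
  \<open>\<Omega>\<close>.\<close>

lemma normal_deriv_limit:
  fixes u :: "'a::euclidean_space \<Rightarrow> real"
  assumes u: "C2_closure \<Omega> u" and \<Omega>: "open \<Omega>" and x0: "x0 \<in> frontier \<Omega>"
  shows "((\<lambda>x. frechet_derivative u (at x) \<nu>) \<longlongrightarrow> normal_deriv \<Omega> u x0 \<nu>) (at x0 within \<Omega>)"
proof -
  have x0': "x0 \<in> closure \<Omega>" "x0 \<notin> \<Omega>"
    using x0 \<Omega> by (auto simp: frontier_def interior_open)
  then have nt: "at x0 within \<Omega> \<noteq> bot"
    by (simp add: trivial_limit_within islimpt_in_closure)
  have "\<forall>b\<in>Basis. \<exists>g. continuous_on (closure \<Omega>) g \<and> (\<forall>x\<in>\<Omega>. g x = d1 u b x)"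
    using u by (simp add: C2_closure_def)
  then obtain g where g: "\<And>b. b \<in> Basis \<Longrightarrow> continuous_on (closure \<Omega>) (g b)"
    "\<And>b x. b \<in> Basis \<Longrightarrow> x \<in> \<Omega> \<Longrightarrow> g b x = d1 u b x"
    by metis
  have "(g b \<longlongrightarrow> g b x0) (at x0 within \<Omega>)" if "b \<in> Basis" for b
    using g(1)[OF that] x0' closure_subset[of \<Omega>]
    by (meson continuous_on_def tendsto_within_subset)
  then have "((\<lambda>x. \<Sum>b\<in>Basis. (\<nu> \<bullet> b) * g b x) \<longlongrightarrow> (\<Sum>b\<in>Basis. (\<nu> \<bullet> b) * g b x0)) (at x0 within \<Omega>)"
    by (intro tendsto_intros)
  moreover have "eventually (\<lambda>x. (\<Sum>b\<in>Basis. (\<nu> \<bullet> b) * g b x) = frechet_derivative u (at x) \<nu>) (at x0 within \<Omega>)"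
    unfolding eventually_at_filter
  proof (intro always_eventually allI impI)
    fix x assume x: "x \<in> \<Omega>"
    then have "u differentiable (at x)"
      using u by (simp add: C2_closure_def C2_on_def)
    then show "(\<Sum>b\<in>Basis. (\<nu> \<bullet> b) * g b x) = frechet_derivative u (at x) \<nu>"
      using x by (simp add: frechet_derivative_eq_sum_d1 g(2))
  qed
  ultimately have "((\<lambda>x. frechet_derivative u (at x) \<nu>) \<longlongrightarrow> (\<Sum>b\<in>Basis. (\<nu> \<bullet> b) * g b x0)) (at x0 within \<Omega>)"
    by (rule Lim_transform_eventually)
  moreover from this have "normal_deriv \<Omega> u x0 \<nu> = (\<Sum>b\<in>Basis. (\<nu> \<bullet> b) * g b x0)"
    unfolding normal_deriv_def by (rule tendsto_Lim[OF nt])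
  ultimately show ?thesis by simp
qed

theorem theorem3p2:
  fixes s c0 R0 :: real
    and \<Omega> :: "'a::euclidean_space set"
    and q :: "'a \<Rightarrow> 'a"
    and u :: "'a \<Rightarrow> real"
    and x0 :: 'a
  assumes s: "0 < s" "s < 1"
    and dom: "C2_domain \<Omega>" "bounded \<Omega>"
    and q_meas: "q \<in> borel_measurable (lebesgue_on \<Omega>)"
    and q_bdd: "\<exists>C. AE x in lebesgue_on \<Omega>. norm (q x) \<le> C"
    and u_C2: "C2_closure \<Omega> u"
    and u_cont: "continuous_on UNIV u"
    and u_bdd: "bounded (range u)"
    and ineq: "AE x in lebesgue_on \<Omega>.
                 - laplacian u x + frac_lap s u x + frechet_derivative u (at x) (q x) \<ge> 0"
    and x0: "x0 \<in> frontier \<Omega>"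
    and R0: "R0 > 0" "\<forall>x \<in> ball x0 R0 \<inter> frontier \<Omega>. u x = c0"
    and ge: "\<forall>x. u x \<ge> c0"
    and nonconst: "\<exists>x. u x \<noteq> c0"
  shows "\<forall>\<nu>. outer_unit_normal \<Omega> x0 \<nu> \<longrightarrow> normal_deriv \<Omega> u x0 \<nu> < 0"
proof (intro allI impI)
  fix \<nu> assume \<nu>: "outer_unit_normal \<Omega> x0 \<nu>"
  have op: "open \<Omega>" and C2: "C2_on \<Omega> u"
    using dom u_C2 by (auto simp: C2_domain_def C2_closure_def)
  have ux0: "u x0 = c0"
    using R0 x0 by simp
  obtain C where C: "0 \<le> C" "\<And>x. x \<in> \<Omega> \<Longrightarrow>
    0 \<le> - laplacian u x + frac_const DIM('a) s * sym_frac s u x + C * (\<Sum>b\<in>Basis. \<bar>d1 u b x\<bar>)"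
    by (rule supersolution_everywhere[OF s u_cont op C2 u_bdd q_bdd ineq]) blast
  have pos: "c0 < u x" if "x \<in> \<Omega>" for x
    using strong_minimum_principle[OF s u_cont op C2 u_bdd C(2) _ nonconst that] ge by blast
  obtain r where r: "0 < r" "norm \<nu> = 1" "ball (x0 - r *\<^sub>R \<nu>) r \<subseteq> \<Omega>"
    by (rule interior_ball[OF op x0 \<nu>])
  obtain \<epsilon> \<alpha> where bar: "0 < \<epsilon>" "0 < \<alpha>" "\<And>x. x \<in> ball (x0 - r *\<^sub>R \<nu>) r \<Longrightarrow>
    c0 + \<epsilon> * (exp (- \<alpha> * (norm (x - (x0 - r *\<^sub>R \<nu>)))\<^sup>2) - exp (- \<alpha> * r\<^sup>2)) \<le> u x"
    using hopf_barrier[OF s u_cont op C2 u_bdd C _ pos r(1,3)] ge by blast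
  \<comment> \<open>Half the slope of the barrier at \<open>x0\<close> along the inner normal. Half
    is available for all \<open>t\<close> between 0 and \<open>r\<close>, since \<open>r\<^sup>2 -
    (r - t)\<^sup>2 = 2 * r * t - t\<^sup>2 \<ge> r * t\<close>.\<close>
  define \<kappa> where "\<kappa> = \<epsilon> * exp (- \<alpha> * r\<^sup>2) * \<alpha> * r"
  have \<kappa>: "0 < \<kappa>"
    using bar r by (simp add: \<kappa>_def)
  have dist_y: "norm (x0 - t *\<^sub>R \<nu> - (x0 - r *\<^sub>R \<nu>)) = \<bar>r - t\<bar>" for t
    using r(2) by (simp flip: scaleR_diff_left)
  have in_ball: "x0 - t *\<^sub>R \<nu> \<in> ball (x0 - r *\<^sub>R \<nu>) r" if "0 < t" "t < r" for t
    using dist_y[of t] that by (simp add: dist_norm norm_minus_commute)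
  have growth: "c0 + \<kappa> * t \<le> u (x0 - t *\<^sub>R \<nu>)" if t: "0 < t" "t < r" for t
  proof -
    have "\<kappa> * t = \<epsilon> * (exp (- \<alpha> * r\<^sup>2) * (\<alpha> * (r * t)))"
      by (simp add: \<kappa>_def)
    also have "\<dots> \<le> \<epsilon> * (exp (- \<alpha> * r\<^sup>2) * (\<alpha> * (r\<^sup>2 - (r - t)\<^sup>2)))"
      using t bar by (intro mult_left_mono) (auto simp: power2_eq_square algebra_simps)
    also have "\<dots> \<le> \<epsilon> * (exp (- \<alpha> * r\<^sup>2) * (exp (\<alpha> * (r\<^sup>2 - (r - t)\<^sup>2)) - 1))"
    proof (intro mult_left_mono)
      show "\<alpha> * (r\<^sup>2 - (r - t)\<^sup>2) \<le> exp (\<alpha> * (r\<^sup>2 - (r - t)\<^sup>2)) - 1"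
        using exp_ge_add_one_self[of "\<alpha> * (r\<^sup>2 - (r - t)\<^sup>2)"] by linarith
    qed (use bar in auto)
    also have "exp (- \<alpha> * r\<^sup>2) * (exp (\<alpha> * (r\<^sup>2 - (r - t)\<^sup>2)) - 1) = exp (- \<alpha> * (r - t)\<^sup>2) - exp (- \<alpha> * r\<^sup>2)"
      by (simp add: right_diff_distrib flip: exp_add)
    finally show ?thesis
      using bar(3)[OF in_ball[OF t]] unfolding dist_y by simp
  qed
  \<comment> \<open>A nonnegative limit would force the derivative along \<open>\<nu>\<close> above
    \<open>- \<kappa>\<close> near \<open>x0\<close>, whereas the linear growth and the mean value
    theorem on a short inner normal segment produce a point where it is at most
    \<open>- \<kappa>\<close>.\<close>
  show "normal_deriv \<Omega> u x0 \<nu> < 0"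
  proof (rule ccontr)
    assume "\<not> normal_deriv \<Omega> u x0 \<nu> < 0"
    then have "- \<kappa> < normal_deriv \<Omega> u x0 \<nu>"
      using \<kappa> by linarith
    then have "eventually (\<lambda>x. - \<kappa> < frechet_derivative u (at x) \<nu>) (at x0 within \<Omega>)"
      by (rule order_tendstoD[OF normal_deriv_limit[OF u_C2 op x0]])
    then obtain d where d: "0 < d"
      "\<And>x. x \<in> \<Omega> \<Longrightarrow> x \<noteq> x0 \<Longrightarrow> dist x x0 < d \<Longrightarrow> - \<kappa> < frechet_derivative u (at x) \<nu>"
      unfolding eventually_at by blast
    define t where "t = min d r / 2"
    have t: "0 < t" "t < d" "t < r"
      using d r by (auto simp: t_def min_def)
    have der: "((\<lambda>\<tau>. u (x0 - \<tau> *\<^sub>R \<nu>)) has_derivative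
        (\<lambda>h. frechet_derivative u (at (x0 - \<tau> *\<^sub>R \<nu>)) (- (h *\<^sub>R \<nu>)))) (at \<tau>)"
      if "0 < \<tau>" "\<tau> < t" for \<tau>
    proof (rule has_derivative_compose[where f = "\<lambda>\<tau>. x0 - \<tau> *\<^sub>R \<nu>"])
      show "((\<lambda>\<tau>. x0 - \<tau> *\<^sub>R \<nu>) has_derivative (\<lambda>h. - (h *\<^sub>R \<nu>))) (at \<tau>)"
        by (auto intro!: derivative_eq_intros)
      have "x0 - \<tau> *\<^sub>R \<nu> \<in> \<Omega>"
        using in_ball[of \<tau>] that t r(3) by auto
      then show "(u has_derivative frechet_derivative u (at (x0 - \<tau> *\<^sub>R \<nu>))) (at (x0 - \<tau> *\<^sub>R \<nu>))"
        using C2 frechet_derivative_works unfolding C2_on_def by blast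
    qed
    \<comment> \<open>Differentiability is available on the open segment inside
      \<open>\<Omega>\<close>; at the endpoint \<open>x0\<close> the continuity of \<open>u\<close>
      on the whole space takes over.\<close>
    have "continuous_on {0..t} (\<lambda>\<tau>. u (x0 - \<tau> *\<^sub>R \<nu>))"
      by (intro continuous_on_compose2[OF u_cont] continuous_intros) auto
    from mvt[OF t(1) this der] obtain \<tau> where \<tau>: "0 < \<tau>" "\<tau> < t"
      "u (x0 - t *\<^sub>R \<nu>) - u (x0 - 0 *\<^sub>R \<nu>) = frechet_derivative u (at (x0 - \<tau> *\<^sub>R \<nu>)) (- ((t - 0) *\<^sub>R \<nu>))"
      by blast
    have \<tau>\<Omega>: "x0 - \<tau> *\<^sub>R \<nu> \<in> \<Omega>"
      using in_ball[of \<tau>] \<tau> t r(3) by auto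
    then have "linear (frechet_derivative u (at (x0 - \<tau> *\<^sub>R \<nu>)))"
      using C2 linear_frechet_derivative unfolding C2_on_def by blast
    then have "frechet_derivative u (at (x0 - \<tau> *\<^sub>R \<nu>)) (- (t *\<^sub>R \<nu>)) = - t * frechet_derivative u (at (x0 - \<tau> *\<^sub>R \<nu>)) \<nu>"
      by (simp add: linear_neg linear_scale)
    with \<tau>(3) ux0 growth[OF t(1,3)]
    have "t * \<kappa> \<le> t * (- frechet_derivative u (at (x0 - \<tau> *\<^sub>R \<nu>)) \<nu>)"
      by (simp add: mult.commute)
    then have "\<kappa> \<le> - frechet_derivative u (at (x0 - \<tau> *\<^sub>R \<nu>)) \<nu>"
      using t(1) by (rule mult_left_le_imp_le)
    moreover have "- \<kappa> < frechet_derivative u (at (x0 - \<tau> *\<^sub>R \<nu>)) \<nu>"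
    proof (rule d(2)[OF \<tau>\<Omega>])
      show "x0 - \<tau> *\<^sub>R \<nu> \<noteq> x0"
        using \<tau> r(2) by auto
      show "dist (x0 - \<tau> *\<^sub>R \<nu>) x0 < d"
        using \<tau> t r(2) by (simp add: dist_norm)
    qed
    ultimately show False by linarith
  qed
qed

end
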